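(* Let $m$ be a fixed constant. For inputs $(A,d,c,x^* )$ to CONFIG-SP (see context) with $m$ constraints in which $x^*$ is an extreme point of $\{x\in[0,1]^n: Ax\le d\}$, a $(1,k)$-configuration inequality (for some $k$), with respect to some row constraint of $Ax\le d$, that is violated by $x^*$ can be found in polynomial time, if one exists.
   Context: $\mathbb{Z}_+$ denotes the nonnegative integers. An input to CONFIG-SP consists of $A\in\mathbb{Z}_+^{m\times n}$, $d\in\mathbb{Z}_+^m$, $c\in\mathbb{Z}_+^n$ and an optimal solution $x^*$ to the LP relaxation $\max\{c^{\mathsf T}x: Ax\le d,\ x\in[0,1]^n\}$. With respect to a row constraint $a^{\mathsf T}x\le b$ of $Ax\le d$: a cover is a set $C\subseteq\{1,\dots,n\}$ with $\sum_{i\in C}a_i>b$; a minimal cover is a cover $C$ with $\sum_{i\in C\setminus\{j\}}a_i\le b$ for every $j\in C$. A set $N\cup\{t\}$ with $N\subsetneq\{1,\dots,n\}$ and $t\in\{1,\dots,n\}\setminus N$ is a $(1,k)$-configuration, for $k\in\{2,\dots,|N|\}$, if $\sum_{i\in N}a_i\le b$ and $Q\cup\{t\}$ is a minimal cover for every $Q\subseteq N$ with $|Q|=k$. Its $(1,k)$-configuration inequalities are $(|S|-k+1)x_t+\sum_{i\in S}x_i\le|S|$ for $S\subseteq N$ with $|S|\ge k$. "Violated by $x^*$" (separating) means that $x^*$ does not satisfy the inequality. *)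

theory Defs
  imports
    "Jordan_Normal_Form.Matrix"
    "HOL-Library.Log_Nat"
    "HOL-Computational_Algebra.Polynomial"
begin

text \<open>The machine model is the random access machine over the natural numbers in structured form:
  a fixed program works on finitely many memory arrays, with indirect addressing. Every evaluated
  number is charged its binary length (logarithmic cost criterion), so a run of cost t only
  produces numbers with at most t bits. Polynomial time in this model therefore coincides with
  polynomial time on Turing machines.\<close>

type_synonym vname = string
type_synonym state = "vname \<Rightarrow> nat \<Rightarrow> nat"

datatype aexp =
    Lit nat
  | Elem vname aexp
  | Plus aexp aexp
  | Monus aexp aexp
  | Times aexp aexp
  | Quot aexp aexp

datatype bexp =
    Less aexp aexp
  | Neg bexp
  | Conj bexp bexp

datatype com =
    Skip
  | Assign vname aexp aexp
  | Seq com com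
  | Ite bexp com com
  | While bexp com

text \<open>The extra 1 pays for a separator and makes zero cost something.\<close>

definition nbits :: "nat \<Rightarrow> nat" where
  "nbits a = floorlog 2 a + 1"

fun aval :: "aexp \<Rightarrow> state \<Rightarrow> nat" where
  "aval (Lit c) s = c"
| "aval (Elem x e) s = s x (aval e s)"
| "aval (Plus e f) s = aval e s + aval f s"
| "aval (Monus e f) s = aval e s - aval f s"
| "aval (Times e f) s = aval e s * aval f s"
| "aval (Quot e f) s = aval e s div aval f s"

fun acost :: "aexp \<Rightarrow> state \<Rightarrow> nat" where
  "acost (Lit c) s = nbits c"
| "acost (Elem x e) s = acost e s + nbits (aval (Elem x e) s)"
| "acost (Plus e f) s = acost e s + acost f s + nbits (aval (Plus e f) s)"
| "acost (Monus e f) s = acost e s + acost f s + nbits (aval (Monus e f) s)"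
| "acost (Times e f) s = acost e s + acost f s + nbits (aval (Times e f) s)"
| "acost (Quot e f) s = acost e s + acost f s + nbits (aval (Quot e f) s)"

fun bval :: "bexp \<Rightarrow> state \<Rightarrow> bool" where
  "bval (Less e f) s \<longleftrightarrow> aval e s < aval f s"
| "bval (Neg b) s \<longleftrightarrow> \<not> bval b s"
| "bval (Conj b c) s \<longleftrightarrow> bval b s \<and> bval c s"

fun bcost :: "bexp \<Rightarrow> state \<Rightarrow> nat" where
  "bcost (Less e f) s = acost e s + acost f s + 1"
| "bcost (Neg b) s = bcost b s + 1"
| "bcost (Conj b c) s = bcost b s + bcost c s + 1"

text \<open>\<open>exec c s t s'\<close>: started in \<open>s\<close>, the program \<open>c\<close> halts in \<open>s'\<close> after a run of cost \<open>t\<close>.\<close>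

inductive exec :: "com \<Rightarrow> state \<Rightarrow> nat \<Rightarrow> state \<Rightarrow> bool" where
  exec_Skip: "exec Skip s 1 s"
| exec_Assign:
    "exec (Assign x e f) s (acost e s + acost f s + 1) (s(x := (s x)(aval e s := aval f s)))"
| exec_Seq:
    "exec c s t s' \<Longrightarrow> exec d s' u s'' \<Longrightarrow> exec (Seq c d) s (t + u + 1) s''"
| exec_IteTrue:
    "bval b s \<Longrightarrow> exec c s t s' \<Longrightarrow> exec (Ite b c d) s (bcost b s + t + 1) s'"
| exec_IteFalse:
    "\<not> bval b s \<Longrightarrow> exec d s t s' \<Longrightarrow> exec (Ite b c d) s (bcost b s + t + 1) s'"
| exec_WhileFalse:
    "\<not> bval b s \<Longrightarrow> exec (While b c) s (bcost b s + 1) s"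
| exec_WhileTrue:
    "bval b s \<Longrightarrow> exec c s t s' \<Longrightarrow> exec (While b c) s' u s'' \<Longrightarrow>
     exec (While b c) s (bcost b s + t + u + 1) s''"

inductive_cases SkipE: "exec Skip s t s'"
inductive_cases AssignE: "exec (Assign x e f) s t s'"
inductive_cases SeqE: "exec (Seq c d) s t s'"
inductive_cases IteE: "exec (Ite b c d) s t s'"
inductive_cases WhileE: "exec (While b c) s t s'"

lemma exec_deterministic:
  "exec c s t s' \<Longrightarrow> exec c s u s'' \<Longrightarrow> u = t \<and> s'' = s'"
proof (induction arbitrary: u s'' rule: exec.induct)
  case (exec_Skip s)
  then show ?case by (elim SkipE) simp
next
  case (exec_Assign x e f s)
  then show ?case by (elim AssignE) simp
next
  case (exec_Seq c s t s1 d v s2)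
  from exec_Seq.prems show ?case
  proof (rule SeqE)
    fix t' v' r
    assume u: "u = Suc (t' + v')" and c: "exec c s t' r" and d: "exec d r v' s''"
    from exec_Seq.IH(1)[OF c] have "t' = t" "r = s1" by simp_all
    with exec_Seq.IH(2) d u show ?thesis by fastforce
  qed
next
  case (exec_IteTrue b s c t s1 d)
  from exec_IteTrue.prems show ?case
  proof (rule IteE)
    fix t'
    assume "u = Suc (bcost b s + t')" and "exec c s t' s''"
    with exec_IteTrue.IH show ?thesis by fastforce
  qed (use exec_IteTrue.hyps in blast)
next
  case (exec_IteFalse b s d t s1 c)
  from exec_IteFalse.prems show ?case
  proof (rule IteE)
    fix t'
    assume "u = Suc (bcost b s + t')" and "exec d s t' s''"
    with exec_IteFalse.IH show ?thesis by fastforce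
  qed (use exec_IteFalse.hyps in blast)
next
  case (exec_WhileFalse b s c)
  from exec_WhileFalse.prems show ?case
    by (rule WhileE) (use exec_WhileFalse.hyps in simp_all)
next
  case (exec_WhileTrue b s c t s1 v s2)
  from exec_WhileTrue.prems show ?case
  proof (rule WhileE)
    fix t' r v'
    assume u: "u = Suc (bcost b s + t' + v')" and c: "exec c s t' r" and d: "exec (While b c) r v' s''"
    from exec_WhileTrue.IH(1)[OF c] have "t' = t" "r = s1" by simp_all
    with exec_WhileTrue.IH(2) d u show ?thesis by fastforce
  qed (use exec_WhileTrue.hyps in blast)
qed

text \<open>A word of numbers is stored in an array with its length at index 0; every other array is
  initially zero.\<close>

definition load :: "nat list \<Rightarrow> state" where
  "load ws = (\<lambda>x i. if x = ''in'' then
      (if i = 0 then length ws else if i \<le> length ws then ws ! (i - 1) else 0) else 0)"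

definition result :: "state \<Rightarrow> nat list" where
  "result s = map (s ''out'') [1..<Suc (s ''out'' 0)]"

definition word_size :: "nat list \<Rightarrow> nat" where
  "word_size ws = (\<Sum>w\<leftarrow>ws. nbits w)"

text \<open>A search problem: inputs from \<open>D\<close>, encoded by \<open>enc\<close>; \<open>R I ys\<close> means that the word \<open>ys\<close>
  is a correct answer for \<open>I\<close>.\<close>

definition solvable_in_polynomial_time ::
    "('i \<Rightarrow> nat list) \<Rightarrow> 'i set \<Rightarrow> ('i \<Rightarrow> nat list \<Rightarrow> bool) \<Rightarrow> bool" where
  "solvable_in_polynomial_time enc D R \<longleftrightarrow>
     (\<exists>(c :: com) (p :: nat poly). \<forall>I\<in>D. \<exists>t s.
        exec c (load (enc I)) t s \<and> t \<le> poly p (word_size (enc I)) \<and> R I (result s))"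

text \<open>Indices run from 0 to n - 1. The constraint is \<open>a \<bullet> x \<le> b\<close> with \<open>n = dim_vec a\<close>.\<close>

definition cover :: "nat vec \<Rightarrow> nat \<Rightarrow> nat set \<Rightarrow> bool" where
  "cover a b C \<longleftrightarrow> C \<subseteq> {..<dim_vec a} \<and> (\<Sum>i\<in>C. a $ i) > b"

definition minimal_cover :: "nat vec \<Rightarrow> nat \<Rightarrow> nat set \<Rightarrow> bool" where
  "minimal_cover a b C \<longleftrightarrow> cover a b C \<and> (\<forall>j\<in>C. (\<Sum>i\<in>C - {j}. a $ i) \<le> b)"

definition configuration :: "nat vec \<Rightarrow> nat \<Rightarrow> nat set \<Rightarrow> nat \<Rightarrow> nat \<Rightarrow> bool" where
  "configuration a b N t k \<longleftrightarrow>
     N \<subset> {..<dim_vec a} \<and> t \<in> {..<dim_vec a} - N \<and> k \<in> {2..card N} \<and>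
     (\<Sum>i\<in>N. a $ i) \<le> b \<and>
     (\<forall>Q\<subseteq>N. card Q = k \<longrightarrow> minimal_cover a b (Q \<union> {t}))"

definition configuration_ineq :: "nat set \<Rightarrow> nat \<Rightarrow> nat \<Rightarrow> real vec \<Rightarrow> bool" where
  "configuration_ineq S t k x \<longleftrightarrow>
     (real (card S) - real k + 1) * x $ t + (\<Sum>i\<in>S. x $ i) \<le> real (card S)"

definition polytope :: "nat mat \<Rightarrow> nat vec \<Rightarrow> real vec set" where
  "polytope A d = {x \<in> carrier_vec (dim_col A).
     map_mat real A *\<^sub>v x \<le> map_vec real d \<and> (\<forall>i<dim_col A. 0 \<le> x $ i \<and> x $ i \<le> 1)}"

text \<open>The library's notion of extreme point needs a type of class \<open>real_vector\<close>, which
  vectors of variable dimension do not form; this is its unfolding.\<close>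

definition extreme_point :: "real vec \<Rightarrow> real vec set \<Rightarrow> bool" where
  "extreme_point x P \<longleftrightarrow> x \<in> P \<and>
     \<not> (\<exists>y\<in>P. \<exists>z\<in>P. \<exists>u. y \<noteq> z \<and> 0 < u \<and> u < 1 \<and> x = (1 - u) \<cdot>\<^sub>v y + u \<cdot>\<^sub>v z)"

record config_sp =
  mat_A :: "nat mat"
  rhs_d :: "nat vec"
  obj_c :: "nat vec"
  opt_x :: "rat vec"

definition real_x :: "config_sp \<Rightarrow> real vec" where
  "real_x I = map_vec of_rat (opt_x I)"

definition optimal_solution :: "nat mat \<Rightarrow> nat vec \<Rightarrow> nat vec \<Rightarrow> real vec \<Rightarrow> bool" where
  "optimal_solution A d c x \<longleftrightarrow> x \<in> polytope A d \<and>
     (\<forall>y\<in>polytope A d. map_vec real c \<bullet> y \<le> map_vec real c \<bullet> x)"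

definition config_sp_input :: "config_sp \<Rightarrow> bool" where
  "config_sp_input I \<longleftrightarrow>
     rhs_d I \<in> carrier_vec (dim_row (mat_A I)) \<and> obj_c I \<in> carrier_vec (dim_col (mat_A I)) \<and>
     optimal_solution (mat_A I) (rhs_d I) (obj_c I) (real_x I)"

text \<open>Binary encoding; a nonnegative rational is given by numerator and denominator in lowest
  terms.\<close>

definition enc_rat :: "rat \<Rightarrow> nat list" where
  "enc_rat q = [nat (fst (quotient_of q)), nat (snd (quotient_of q))]"

definition enc_input :: "config_sp \<Rightarrow> nat list" where
  "enc_input I = [dim_row (mat_A I), dim_col (mat_A I)]
     @ concat (map (\<lambda>r. list_of_vec (row (mat_A I) r)) [0..<dim_row (mat_A I)])
     @ list_of_vec (rhs_d I) @ list_of_vec (obj_c I)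
     @ concat (map enc_rat (list_of_vec (opt_x I)))"

definition violated_configuration ::
    "config_sp \<Rightarrow> nat \<Rightarrow> nat set \<Rightarrow> nat \<Rightarrow> nat \<Rightarrow> nat set \<Rightarrow> bool" where
  "violated_configuration I r N t k S \<longleftrightarrow>
     r < dim_row (mat_A I) \<and> configuration (row (mat_A I) r) (rhs_d I $ r) N t k \<and>
     S \<subseteq> N \<and> k \<le> card S \<and> \<not> configuration_ineq S t k (real_x I)"

definition enc_set :: "nat \<Rightarrow> nat set \<Rightarrow> nat list" where
  "enc_set n S = map (\<lambda>i. of_bool (i \<in> S)) [0..<n]"

text \<open>The answer is a violated inequality, presented by its row, configuration and \<open>S\<close>, or the
  report \<open>[0]\<close> that there is none.\<close>

definition config_sp_answer :: "config_sp \<Rightarrow> nat list \<Rightarrow> bool" where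
  "config_sp_answer I ys \<longleftrightarrow>
     (if \<exists>r N t k S. violated_configuration I r N t k S
      then \<exists>r N t k S. violated_configuration I r N t k S \<and>
             ys = [1, r, t, k] @ enc_set (dim_col (mat_A I)) N @ enc_set (dim_col (mat_A I)) S
      else ys = [0])"

end

theory Submission
  imports Defs
begin

text \<open>An extreme point has at most \<open>m\<close> fractional coordinates. In a violated inequality one may take
  \<open>N = S\<close> and \<open>x\<^sub>i > 0\<close> on \<open>S\<close>. Order the indices by weight. Either some minimal cover \<open>C\<close> with at
  least three elements has \<open>\<Sum>i\<in>C. (1 - x\<^sub>i) < 1\<close>, and then there is one consisting of an interval of
  the indices with \<open>x\<^sub>i = 1\<close>, some fractional indices and one further element. Or there is none, and
  then \<open>S\<close> itself consists of an interval of the ones, at most \<open>m + 1\<close> additional indices and up to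
  \<open>2 m\<close> omitted ones. In both cases \<open>S\<close> is determined by a bounded number of indices, so all
  candidates can be tried. The search is written in a language of arithmetic expressions with
  polynomially bounded sums and products, which is compiled to the machine.\<close>

subsection \<open>Polynomial bounds and program cost\<close>

text \<open>Two exponential searches have to be avoided: over the subsets \<open>Q\<close> of size
  \<open>k\<close> in a configuration, and over \<open>S\<close>. For the first, only the
  \<open>k\<close> lightest and the \<open>k - 1\<close> heaviest elements of \<open>S\<close>
  matter. For the second, the obstacle is that the ones in \<open>S\<close> are unbounded in number
  and need not form an interval. The case split on minimal covers controls the holes. In the second
  case fewer than \<open>k\<close> elements of \<open>S\<close> are ones, and ones that fit with
  \<open>t\<close> individually also fit with it all together. The ones of \<open>S\<close>,
  completed by fractional elements to size \<open>k\<close>, overflow next to \<open>t\<close>; so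
  the omitted ones weigh less than these at most \<open>m\<close> fractional elements. Since the
  heaviest weight in \<open>S\<close> is less than twice the second smallest, this bound on weight
  becomes the bound \<open>2 * m\<close> on number. The smallest element escapes the comparison,
  which accounts for \<open>m + 1\<close> in place of \<open>m\<close>.\<close>

definition poly_bounded :: "(nat \<Rightarrow> nat) \<Rightarrow> bool" where
  "poly_bounded f \<longleftrightarrow> (\<exists>p. \<forall>n. f n \<le> poly p n)"

named_theorems poly_bounded_intros

lemma poly_bounded_const [poly_bounded_intros]: "poly_bounded (\<lambda>n. c)"
  unfolding poly_bounded_def by (rule exI[of _ "[:c:]"]) simp

lemma poly_bounded_ident [poly_bounded_intros]: "poly_bounded (\<lambda>n. n)"
  unfolding poly_bounded_def by (rule exI[of _ "[:0, 1:]"]) simp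

lemma poly_bounded_add [poly_bounded_intros]:
  assumes "poly_bounded f" "poly_bounded g"
  shows "poly_bounded (\<lambda>n. f n + g n)"
proof -
  from assms obtain p q where "\<forall>n. f n \<le> poly p n" "\<forall>n. g n \<le> poly q n"
    unfolding poly_bounded_def by blast
  then have "\<forall>n. f n + g n \<le> poly (p + q) n" by (simp add: add_mono)
  then show ?thesis unfolding poly_bounded_def by blast
qed

lemma poly_bounded_mult [poly_bounded_intros]:
  assumes "poly_bounded f" "poly_bounded g"
  shows "poly_bounded (\<lambda>n. f n * g n)"
proof -
  from assms obtain p q where "\<forall>n. f n \<le> poly p n" "\<forall>n. g n \<le> poly q n"
    unfolding poly_bounded_def by blast
  then have "\<forall>n. f n * g n \<le> poly (p * q) n" by (simp add: mult_mono)
  then show ?thesis unfolding poly_bounded_def by blast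
qed

lemma poly_bounded_Suc [poly_bounded_intros]:
  "poly_bounded f \<Longrightarrow> poly_bounded (\<lambda>n. Suc (f n))"
  using poly_bounded_add[OF _ poly_bounded_const[of 1], of f] by simp

lemma poly_bounded_power [poly_bounded_intros]:
  "poly_bounded f \<Longrightarrow> poly_bounded (\<lambda>n. f n ^ k)"
  by (induction k) (auto intro: poly_bounded_intros)

section \<open>Bit lengths and runs within a cost budget\<close>

lemma nbits_le:
  assumes "a < 2 ^ B"
  shows "nbits a \<le> Suc B"
proof (cases "a = 0")
  case True
  then show ?thesis by (simp add: nbits_def floorlog_def)
next
  case False
  then show ?thesis using assms by (simp add: nbits_def floorlog_leI)
qed

lemma le_nbits: "1 \<le> nbits a"
  by (simp add: nbits_def)

lemma less_power_nbits: "a < 2 ^ nbits a"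
proof -
  have "a < 2 ^ floorlog 2 a" 
    by (cases "a = 0") (use floorlog_bounds[of a 2] in \<open>auto simp: floorlog_def\<close>)
  also have "\<dots> \<le> 2 ^ nbits a" by (simp add: nbits_def)
  finally show ?thesis .
qed

text \<open>A total-correctness triple with a budget in place of the exact cost, so that a loop can
  be charged at the worst round.\<close>

definition runs :: "com \<Rightarrow> state \<Rightarrow> nat \<Rightarrow> (state \<Rightarrow> bool) \<Rightarrow> bool" where
  "runs c s T Q \<longleftrightarrow> (\<exists>t s'. exec c s t s' \<and> t \<le> T \<and> Q s')"

lemma runs_mono:
  "runs c s T Q \<Longrightarrow> T \<le> T' \<Longrightarrow> (\<And>s'. Q s' \<Longrightarrow> Q' s') \<Longrightarrow> runs c s T' Q'"
  unfolding runs_def by (meson order_trans)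

lemma runs_Assign:
  assumes "Q (s(x := (s x)(aval e s := aval f s)))" "acost e s + acost f s + 1 \<le> T"
  shows "runs (Assign x e f) s T Q"
  unfolding runs_def using assms exec_Assign by blast

lemma runs_Seq:
  assumes "runs c s T Q" "\<And>s'. Q s' \<Longrightarrow> runs d s' U R"
  shows "runs (Seq c d) s (T + U + 1) R"
proof -
  obtain t s' where 1: "exec c s t s'" "t \<le> T" "Q s'" using assms(1) unfolding runs_def by blast
  obtain u s'' where 2: "exec d s' u s''" "u \<le> U" "R s''"
    using assms(2)[OF 1(3)] unfolding runs_def by blast
  have "exec (Seq c d) s (t + u + 1) s''" using exec_Seq[OF 1(1) 2(1)] .
  moreover have "t + u + 1 \<le> T + U + 1" using 1(2) 2(2) by simp
  ultimately show ?thesis unfolding runs_def using 2(3) by blast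
qed

lemma runs_While:
  assumes step: "\<And>i s. i < N \<Longrightarrow> J i s \<Longrightarrow> bval b s \<and> bcost b s \<le> U \<and> runs c s T (J (Suc i))"
    and stop: "\<And>s. J N s \<Longrightarrow> \<not> bval b s \<and> bcost b s \<le> U"
    and start: "J 0 s"
  shows "runs (While b c) s (Suc N * (U + T + 1)) (J N)"
proof -
  \<comment> \<open>Induction on the number \<open>i\<close> of rounds left: what remains of the
    loop is a run of the same loop from a later state. The factor \<open>Suc i\<close> includes the
    final, failing test.\<close>
  have "J (N - i) s \<Longrightarrow> i \<le> N \<Longrightarrow> runs (While b c) s (Suc i * (U + T + 1)) (J N)" for i s
  proof (induction i arbitrary: s)
    case 0
    then have "exec (While b c) s (bcost b s + 1) s" "bcost b s \<le> U"
      using stop exec_WhileFalse by simp_all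
    then show ?case unfolding runs_def using 0 by (intro exI[of _ "bcost b s + 1"] exI[of _ s]) auto
  next
    case (Suc i)
    then have "N - Suc i < N" "Suc (N - Suc i) = N - i" by auto
    with step[OF _ Suc.prems(1)] have b: "bval b s" "bcost b s \<le> U" "runs c s T (J (N - i))"
      by simp_all
    then obtain t s' where 1: "exec c s t s'" "t \<le> T" "J (N - i) s'" unfolding runs_def by blast
    then obtain u s'' where 2: "exec (While b c) s' u s''" "u \<le> Suc i * (U + T + 1)" "J N s''"
      using Suc.IH[of s'] Suc.prems(2) unfolding runs_def by auto
    have "exec (While b c) s (bcost b s + t + u + 1) s''"
      using exec_WhileTrue[OF b(1) 1(1) 2(1)] .
    moreover have "bcost b s + t + u + 1 \<le> Suc (Suc i) * (U + T + 1)"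
      using b(2) 1(2) 2(2) by simp
    ultimately show ?case unfolding runs_def using 2(3) by blast
  qed
  from this[of N s] start show ?thesis by simp
qed

section \<open>Expressions and the size of their values\<close>

datatype bop = Add | Sub | Mul | Div

fun bop_val :: "bop \<Rightarrow> nat \<Rightarrow> nat \<Rightarrow> nat" where
  "bop_val Add u v = u + v"
| "bop_val Sub u v = u - v"
| "bop_val Mul u v = u * v"
| "bop_val Div u v = u div v"

fun bop_aexp :: "bop \<Rightarrow> aexp \<Rightarrow> aexp \<Rightarrow> aexp" where
  "bop_aexp Add = Plus"
| "bop_aexp Sub = Monus"
| "bop_aexp Mul = Times"
| "bop_aexp Div = Quot"

lemma aval_bop_aexp [simp]: "aval (bop_aexp p e f) s = bop_val p (aval e s) (aval f s)"
  by (cases p) auto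

lemma acost_bop_aexp [simp]:
  "acost (bop_aexp p e f) s = acost e s + acost f s + nbits (bop_val p (aval e s) (aval f s))"
  by (cases p) auto

text \<open>One bound serves all four operations. Addition is the delicate one:
  \<open>2 ^ B + 2 ^ C \<le> 2 ^ (B + C)\<close> relies on positive \<open>B\<close> and
  \<open>C\<close>, so \<open>bits\<close> is arranged never to be 0.\<close>

lemma bop_val_less:
  assumes u: "u < 2 ^ B" and v: "v < 2 ^ C" and "1 \<le> B" "1 \<le> C"
  shows "bop_val p u v < 2 ^ (B + C)"
proof -
  have b: "(2::nat) \<le> 2 ^ B" "(2::nat) \<le> 2 ^ C"
    using power_increasing[of 1 B "2::nat"] power_increasing[of 1 C "2::nat"] assms by auto
  have "(2::nat) ^ B + 2 ^ C \<le> 2 ^ B * 2 ^ C"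
  proof -
    have "2 * 2 ^ C \<le> (2::nat) ^ B * 2 ^ C" "2 ^ B * 2 \<le> (2::nat) ^ B * 2 ^ C"
      by (rule mult_right_mono[OF b(1)] mult_left_mono[OF b(2)], simp)+
    then show ?thesis by linarith
  qed
  then have "u + v < 2 ^ (B + C)" using u v by (simp add: power_add)
  moreover have "u * v < 2 ^ (B + C)"
    using mult_strict_mono'[OF u v] by (simp add: power_add)
  moreover have "u div v \<le> u + v" by (simp add: trans_le_add1)
  ultimately show ?thesis by (cases p) auto
qed

text \<open>An expression language with input access whose only loops run \<open>inp 0 ^ k\<close> times for a
  constant \<open>k\<close>, where \<open>inp 0\<close> is the length of the input word. All its expressions can therefore
  be evaluated in polynomial time. \<open>Big p c x k e\<close> folds the operation \<open>p\<close>, starting from \<open>c\<close>, over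
  the values of \<open>e\<close> at \<open>x = 0, \<dots>, inp 0 ^ k - 1\<close>.\<close>

datatype expr =
    Cst nat
  | Var nat
  | Inp expr
  | Bin bop expr expr
  | Big bop nat nat nat expr

primrec eval :: "expr \<Rightarrow> (nat \<Rightarrow> nat) \<Rightarrow> (nat \<Rightarrow> nat) \<Rightarrow> nat" where
  "eval (Cst c) inp env = c"
| "eval (Var x) inp env = env x"
| "eval (Inp e) inp env = inp (eval e inp env)"
| "eval (Bin p e f) inp env = bop_val p (eval e inp env) (eval f inp env)"
| "eval (Big p c x k e) inp env =
     fold (\<lambda>i acc. bop_val p acc (eval e inp (env(x := i)))) [0..<inp 0 ^ k] c"

text \<open>\<open>V\<close> bounds the bit lengths of the variables; \<open>W\<close> bounds those
  of the input words and also the number \<open>inp 0\<close>. The accumulator of a fold enters each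
  round only once, so it grows by at most \<open>bits e\<close> bits per round: iterated products
  stay polynomially long, and repeated squaring inside a loop cannot be written.\<close>

primrec bits :: "expr \<Rightarrow> nat \<Rightarrow> nat \<Rightarrow> nat" where
  "bits (Cst c) V W = Suc c"
| "bits (Var x) V W = Suc V"
| "bits (Inp e) V W = Suc W"
| "bits (Bin p e f) V W = bits e V W + bits f V W"
| "bits (Big p c x k e) V W = Suc c + W ^ k * bits e (V + k * W) W"

lemma bits_ge_1: "1 \<le> bits e V W"
  by (induction e arbitrary: V) (auto intro: trans_le_add1)

lemma power_le_power2:
  assumes "(l::nat) < 2 ^ W"
  shows "l ^ k \<le> 2 ^ (k * W)"
proof -
  have "l ^ k \<le> (2 ^ W) ^ k" using assms by (intro power_mono) auto
  then show ?thesis by (simp add: power_mult[symmetric] mult.commute)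
qed

lemma fold_bop_less:
  assumes "\<And>i. i < n \<Longrightarrow> g i < 2 ^ B" "1 \<le> B"
  shows "fold (\<lambda>i acc. bop_val p acc (g i)) [0..<n] c < 2 ^ (Suc c + n * B)"
  using assms
proof (induction n)
  case 0
  have "c < 2 ^ Suc c" using less_exp[of "Suc c"] by linarith
  then show ?case by simp
next
  case (Suc n)
  then have "fold (\<lambda>i acc. bop_val p acc (g i)) [0..<n] c < 2 ^ (Suc c + n * B)" by simp
  from bop_val_less[OF this, of "g n" B] Suc.prems
  show ?case by (simp add: algebra_simps)
qed

lemma eval_less:
  assumes inp: "\<And>i. inp i < 2 ^ W" and len: "inp 0 \<le> W"
  shows "(\<And>x. env x < 2 ^ V) \<Longrightarrow> eval e inp env < 2 ^ bits e V W"
proof (induction e arbitrary: env V)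
  case (Cst c)
  have "c < 2 ^ Suc c" using less_exp[of "Suc c"] by linarith
  then show ?case by simp
next
  case (Var x)
  have "env x < 2 ^ V" using Var .
  also have "\<dots> \<le> 2 ^ Suc V" by simp
  finally show ?case by simp
next
  case (Inp e)
  have "inp (eval e inp env) < 2 ^ W" using inp .
  also have "\<dots> \<le> 2 ^ Suc W" by simp
  finally show ?case by simp
next
  case (Bin p e f)
  then show ?case using bop_val_less[OF _ _ bits_ge_1 bits_ge_1] by simp
next
  case (Big p c x k e)
  let ?B = "bits e (V + k * W) W"
  have "eval e inp (env(x := i)) < 2 ^ ?B" if "i < inp 0 ^ k" for i
  proof (rule Big.IH)
    fix y
    have "i < 2 ^ (k * W)" using that power_le_power2[OF inp] by (rule less_le_trans)
    also have "(2::nat) ^ (k * W) \<le> 2 ^ (V + k * W)" by simp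
    finally have "i < 2 ^ (V + k * W)" .
    moreover have "env y < 2 ^ (V + k * W)"
      using Big.prems[of y] by (rule less_le_trans) simp
    ultimately show "(env(x := i)) y < 2 ^ (V + k * W)" by simp
  qed
  then have "eval (Big p c x k e) inp env < 2 ^ (Suc c + inp 0 ^ k * ?B)"
    using fold_bop_less[where g = "\<lambda>i. eval e inp (env(x := i))"] bits_ge_1 by simp
  also have "(2::nat) ^ (Suc c + inp 0 ^ k * ?B) \<le> 2 ^ (Suc c + W ^ k * ?B)"
    using len by (intro power_increasing add_left_mono mult_right_mono power_mono) auto
  finally show ?case by simp
qed

section \<open>Compilation of expressions and its cost\<close>

abbreviation reg :: "vname \<Rightarrow> nat \<Rightarrow> aexp" where
  "reg a i \<equiv> Elem a (Lit i)"

abbreviation put :: "vname \<Rightarrow> nat \<Rightarrow> aexp \<Rightarrow> com" where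
  "put a i \<equiv> Assign a (Lit i)"

primrec len_power :: "nat \<Rightarrow> aexp" where
  "len_power 0 = Lit 1"
| "len_power (Suc k) = Times (reg ''in'' 0) (len_power k)"

primrec len_power_cost :: "nat \<Rightarrow> nat \<Rightarrow> nat" where
  "len_power_cost 0 W = nbits 1"
| "len_power_cost (Suc k) W = nbits 0 + Suc W + len_power_cost k W + Suc (Suc (Suc k * W))"

lemma aval_len_power [simp]: "aval (len_power k) s = s ''in'' 0 ^ k"
  by (induction k) auto

lemma acost_len_power:
  assumes "s ''in'' 0 < 2 ^ W"
  shows "acost (len_power k) s \<le> len_power_cost k W"
proof (induction k)
  case (Suc k)
  have "s ''in'' 0 ^ Suc k < 2 ^ Suc (Suc k * W)"
    using power_le_power2[OF assms, of "Suc k"] by (rule order.strict_trans1) simp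
  from nbits_le[OF this] nbits_le[OF assms] Suc show ?case by simp
qed simp

text \<open>Array \<open>v\<close> holds the environment, array \<open>t\<close> a stack of temporaries: the value is left at
  \<open>t[d]\<close> and no cell below \<open>d\<close> is touched. A loop saves the outer value of its variable in
  \<open>t[d + 1]\<close>.\<close>

primrec compile :: "expr \<Rightarrow> nat \<Rightarrow> com" where
  "compile (Cst c) d = put ''t'' d (Lit c)"
| "compile (Var x) d = put ''t'' d (reg ''v'' x)"
| "compile (Inp e) d = Seq (compile e d) (put ''t'' d (Elem ''in'' (reg ''t'' d)))"
| "compile (Bin p e f) d =
     Seq (compile e d) (Seq (compile f (Suc d))
       (put ''t'' d (bop_aexp p (reg ''t'' d) (reg ''t'' (Suc d)))))"
| "compile (Big p c x k e) d =
     Seq (put ''t'' d (Lit c))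
    (Seq (put ''t'' (Suc d) (reg ''v'' x))
    (Seq (put ''v'' x (Lit 0))
    (Seq (While (Less (reg ''v'' x) (len_power k))
            (Seq (compile e (Suc (Suc d)))
            (Seq (put ''t'' d (bop_aexp p (reg ''t'' d) (reg ''t'' (Suc (Suc d)))))
                 (put ''v'' x (Plus (reg ''v'' x) (Lit 1))))))
         (put ''v'' x (reg ''t'' (Suc d))))))"

text \<open>The sums are left unsimplified, in the shapes \<open>T + U + 1\<close> and
  \<open>Suc N * (U + T + 1)\<close> of \<open>runs_Seq\<close> and \<open>runs_While\<close>, so
  that the budgets in \<open>runs_compile\<close> match syntactically.\<close>

primrec steps :: "expr \<Rightarrow> nat \<Rightarrow> nat \<Rightarrow> nat \<Rightarrow> nat" where
  "steps (Cst c) d V W = nbits d + nbits c + 1"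
| "steps (Var x) d V W = nbits d + (nbits x + Suc V) + 1"
| "steps (Inp e) d V W =
     steps e d V W + (nbits d + (nbits d + Suc (bits e V W) + Suc W) + 1) + 1"
| "steps (Bin p e f) d V W =
     steps e d V W + (steps f (Suc d) V W +
       (nbits d + (nbits d + Suc (bits e V W) + (nbits (Suc d) + Suc (bits f V W))
         + Suc (bits e V W + bits f V W)) + 1) + 1) + 1"
| "steps (Big p c x k e) d V W =
     (nbits d + nbits c + 1) +
    ((nbits (Suc d) + (nbits x + Suc V) + 1) +
    ((nbits x + nbits 0 + 1) +
    (Suc (W ^ k) *
      ((nbits x + Suc (Suc (k * W)) + len_power_cost k W + 1) +
       (steps e (Suc (Suc d)) (V + k * W) W +
        ((nbits d + (nbits d + Suc (bits (Big p c x k e) V W)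
            + (nbits (Suc (Suc d)) + Suc (bits e (V + k * W) W))
            + Suc (bits (Big p c x k e) V W)) + 1) +
         (nbits x + (nbits x + Suc (Suc (k * W)) + nbits 1 + Suc (Suc (k * W))) + 1) + 1) + 1) + 1) +
     (nbits x + (nbits (Suc d) + Suc V) + 1) + 1) + 1) + 1) + 1"

text \<open>\<open>f\<close> is generalised because each enclosing loop raises the bound on the
  variables by \<open>k * W\<close>. The nesting depth is fixed by \<open>e\<close>, so the result
  remains polynomial in \<open>W\<close>.\<close>

lemma poly_bounded_bits:
  "poly_bounded f \<Longrightarrow> poly_bounded (\<lambda>W. bits e (f W) W)"
proof (induction e arbitrary: f)
  case (Big p c x k e)
  have "poly_bounded (\<lambda>W. bits e (f W + k * W) W)"
    by (intro Big poly_bounded_intros)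
  then show ?case unfolding bits.simps by (intro poly_bounded_intros)
qed (simp only: bits.simps; intro poly_bounded_intros; simp)+

lemma poly_bounded_len_power_cost: "poly_bounded (len_power_cost k)"
  by (induction k) (auto intro!: poly_bounded_intros)

lemma poly_bounded_steps:
  "poly_bounded f \<Longrightarrow> poly_bounded (\<lambda>W. steps e d (f W) W)"
proof (induction e arbitrary: f d)
  case (Big p c x k e)
  have "poly_bounded (\<lambda>W. steps e (Suc (Suc d)) (f W + k * W) W)"
    "poly_bounded (\<lambda>W. bits e (f W + k * W) W)"
    by (intro Big poly_bounded_bits poly_bounded_intros)+
  then show ?case unfolding steps.simps
    by (intro poly_bounded_intros poly_bounded_bits poly_bounded_len_power_cost Big)
qed (simp only: steps.simps; intro poly_bounded_intros poly_bounded_bits; simp)+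

text \<open>Preserving all arrays but \<open>''t''\<close> includes \<open>''v''\<close>: a loop
  restores the outer value of its variable, on which the rest of the enclosing expression
  relies.\<close>

lemma runs_compile:
  assumes inp: "\<And>i. inp i < 2 ^ W" and len: "inp 0 \<le> W"
  shows "s ''in'' = inp \<Longrightarrow> (\<And>x. s ''v'' x < 2 ^ V) \<Longrightarrow>
    runs (compile e d) s (steps e d V W)
      (\<lambda>s'. s' ''t'' d = eval e inp (s ''v'') \<and> (\<forall>i<d. s' ''t'' i = s ''t'' i) \<and>
        (\<forall>a. a \<noteq> ''t'' \<longrightarrow> s' a = s a))"
proof (induction e arbitrary: s d V)
  case (Cst c)
  show ?case unfolding compile.simps steps.simps by (rule runs_Assign) auto
next
  case (Var x)
  then show ?case unfolding compile.simps steps.simps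
    by (intro runs_Assign) (auto intro: nbits_le)
next
  case (Inp e)
  have v: "eval e inp (s ''v'') < 2 ^ bits e V W"
    using eval_less[of inp W, OF inp len] Inp.prems(2) by blast
  show ?case unfolding compile.simps steps.simps
    by (rule runs_Seq[OF Inp.IH[OF Inp.prems] runs_Assign])
      (use Inp.prems nbits_le[OF v] nbits_le[OF inp, of "eval e inp (s ''v'')"] in \<open>auto simp del: One_nat_def\<close>)
next
  case (Bin p e f)
  have v: "eval e inp (s ''v'') < 2 ^ bits e V W" "eval f inp (s ''v'') < 2 ^ bits f V W"
    using eval_less[of inp W, OF inp len] Bin.prems(2) by blast+
  note w = bop_val_less[OF v bits_ge_1 bits_ge_1, of p]
  show ?case unfolding compile.simps steps.simps
  proof (rule runs_Seq[OF Bin.IH(1)[OF Bin.prems]])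
    fix s1
    assume s1: "s1 ''t'' d = eval e inp (s ''v'') \<and> (\<forall>i<d. s1 ''t'' i = s ''t'' i) \<and>
        (\<forall>a. a \<noteq> ''t'' \<longrightarrow> s1 a = s a)"
    show "runs (Seq (compile f (Suc d))
             (put ''t'' d (bop_aexp p (reg ''t'' d) (reg ''t'' (Suc d))))) s1
       (steps f (Suc d) V W +
       (nbits d + (nbits d + Suc (bits e V W) + (nbits (Suc d) + Suc (bits f V W))
         + Suc (bits e V W + bits f V W)) + 1) + 1)
      (\<lambda>s'. s' ''t'' d = eval (Bin p e f) inp (s ''v'') \<and> (\<forall>i<d. s' ''t'' i = s ''t'' i) \<and>
        (\<forall>a. a \<noteq> ''t'' \<longrightarrow> s' a = s a))"
      apply (rule runs_Seq[OF Bin.IH(2)])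
      using s1 Bin.prems apply simp
      using s1 Bin.prems apply simp
      apply (rule runs_Assign)
      using s1 Bin.prems nbits_le[OF v(1)] nbits_le[OF v(2)] nbits_le[OF w] by auto
  qed
next
  case (Big p c x k e)
  define env where "env = s ''v''"
  define A where "A i = fold (\<lambda>i acc. bop_val p acc (eval e inp (env(x := i)))) [0..<i] c" for i
  let ?B = "bits e (V + k * W) W"
  let ?BB = "bits (Big p c x k e) V W"
  \<comment> \<open>At exit the variable equals \<open>inp 0 ^ k\<close>, for which only the
    non-strict bound \<open>2 ^ (k * W)\<close> is available; hence the extra bit.\<close>
  have i_less: "i < 2 ^ Suc (k * W)" if "i \<le> inp 0 ^ k" for i
  proof -
    have "(0::nat) < 2 ^ (k * W)" by simp
    then show ?thesis unfolding power_Suc using that power_le_power2[OF inp, of 0 k] by linarith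
  qed
  have env: "(env(x := i)) y < 2 ^ (V + k * W)" if "i < inp 0 ^ k" for i y
  proof -
    have "i < 2 ^ (k * W)" using that power_le_power2[OF inp] by (rule less_le_trans)
    also have "(2::nat) ^ (k * W) \<le> 2 ^ (V + k * W)" by simp
    finally have "i < 2 ^ (V + k * W)" .
    moreover have "env y < 2 ^ (V + k * W)"
      using Big.prems(2)[of y] unfolding env_def by (rule less_le_trans) simp
    ultimately show ?thesis by simp
  qed
  have body_less: "eval e inp (env(x := i)) < 2 ^ ?B" if "i < inp 0 ^ k" for i
    using eval_less[of inp W, OF inp len env[OF that]] .
  \<comment> \<open>Every intermediate accumulator is charged, so all partial folds need the bound,
    not only the last.\<close>
  have A_less: "A i < 2 ^ ?BB" if "i \<le> inp 0 ^ k" for i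
  proof -
    have "A i < 2 ^ (Suc c + i * ?B)" unfolding A_def
      using fold_bop_less[where g = "\<lambda>i. eval e inp (env(x := i))" and n = i] bits_ge_1 
        body_less that by simp
    also have "i \<le> W ^ k" using that power_mono[OF len, of k] by simp
    then have "(2::nat) ^ (Suc c + i * ?B) \<le> 2 ^ ?BB"
      unfolding bits.simps by (intro power_increasing add_left_mono mult_right_mono) auto
    finally show ?thesis .
  qed
  have A_Suc: "A (Suc i) = bop_val p (A i) (eval e inp (env(x := i)))" for i
    by (simp add: A_def)
  define J where "J i s' \<longleftrightarrow> i \<le> inp 0 ^ k \<and> s' ''t'' d = A i \<and> s' ''t'' (Suc d) = env x \<and>
    (\<forall>i<d. s' ''t'' i = s ''t'' i) \<and> s' ''v'' = env(x := i) \<and>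
    (\<forall>a. a \<noteq> ''t'' \<and> a \<noteq> ''v'' \<longrightarrow> s' a = s a)" for i s'
  let ?U = "nbits x + Suc (Suc (k * W)) + len_power_cost k W + 1"
  let ?T = "steps e (Suc (Suc d)) (V + k * W) W +
        ((nbits d + (nbits d + Suc (bits (Big p c x k e) V W)
            + (nbits (Suc (Suc d)) + Suc (bits e (V + k * W) W))
            + Suc (bits (Big p c x k e) V W)) + 1) +
         (nbits x + (nbits x + Suc (Suc (k * W)) + nbits 1 + Suc (Suc (k * W))) + 1) + 1) + 1"
  have cost: "acost (reg ''v'' x) s' + acost (len_power k) s' + 1 \<le> ?U" if "J i s'" for i s'
  proof -
    have "acost (len_power k) s' \<le> len_power_cost k W"
      using that inp Big.prems(1) by (intro acost_len_power) (simp add: J_def)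
    then show ?thesis using nbits_le[OF i_less, of i] that by (simp add: J_def)
  qed
  have loop: "runs (While (Less (reg ''v'' x) (len_power k))
            (Seq (compile e (Suc (Suc d)))
            (Seq (put ''t'' d (bop_aexp p (reg ''t'' d) (reg ''t'' (Suc (Suc d)))))
                 (put ''v'' x (Plus (reg ''v'' x) (Lit 1)))))) s'
       (Suc (W ^ k) * (?U + ?T + 1)) (J (inp 0 ^ k))" if "J 0 s'" for s'
  proof (rule runs_mono[OF runs_While[where J = J and N = "inp 0 ^ k" and U = ?U and T = ?T]])
    fix i s'
    assume i: "i < inp 0 ^ k" and J: "J i s'"
    have "runs (Seq (compile e (Suc (Suc d)))
            (Seq (put ''t'' d (bop_aexp p (reg ''t'' d) (reg ''t'' (Suc (Suc d)))))
                 (put ''v'' x (Plus (reg ''v'' x) (Lit 1))))) s' ?T (J (Suc i))"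
    proof (rule runs_Seq[OF Big.IH])
      show "s' ''in'' = inp" "s' ''v'' y < 2 ^ (V + k * W)" for y
        using J Big.prems(1) env[OF i] by (auto simp: J_def)
    next
      fix s1
      assume s1: "s1 ''t'' (Suc (Suc d)) = eval e inp (s' ''v'') \<and>
          (\<forall>i<Suc (Suc d). s1 ''t'' i = s' ''t'' i) \<and> (\<forall>a. a \<noteq> ''t'' \<longrightarrow> s1 a = s' a)"
      have nb: "nbits (A i) \<le> Suc ?BB" "nbits (A (Suc i)) \<le> Suc ?BB"
        "nbits (eval e inp (env(x := i))) \<le> Suc ?B"
        "nbits i \<le> Suc (Suc (k * W))" "nbits (i + 1) \<le> Suc (Suc (k * W))"
        using i by (intro nbits_le A_less i_less body_less; simp)+
      have s1': "s1 ''t'' d = A i" "s1 ''t'' (Suc d) = env x" "s1 ''v'' = env(x := i)"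
        "s1 ''t'' (Suc (Suc d)) = eval e inp (env(x := i))"
        "\<forall>i<d. s1 ''t'' i = s ''t'' i" "\<forall>a. a \<noteq> ''t'' \<and> a \<noteq> ''v'' \<longrightarrow> s1 a = s a"
        using s1 J by (auto simp: J_def)
      show "runs (Seq (put ''t'' d (bop_aexp p (reg ''t'' d) (reg ''t'' (Suc (Suc d)))))
                 (put ''v'' x (Plus (reg ''v'' x) (Lit 1)))) s1
        ((nbits d + (nbits d + Suc (bits (Big p c x k e) V W)
            + (nbits (Suc (Suc d)) + Suc (bits e (V + k * W) W))
            + Suc (bits (Big p c x k e) V W)) + 1) +
         (nbits x + (nbits x + Suc (Suc (k * W)) + nbits 1 + Suc (Suc (k * W))) + 1) + 1) (J (Suc i))"
      proof (rule runs_Seq[where Q = "\<lambda>s2. s2 = s1(''t'' := (s1 ''t'')(d := A (Suc i)))",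
            OF runs_Assign runs_Assign])
        show "acost (Lit d) s1 +
            acost (bop_aexp p (reg ''t'' d) (reg ''t'' (Suc (Suc d)))) s1 + 1
          \<le> nbits d + (nbits d + Suc ?BB + (nbits (Suc (Suc d)) + Suc ?B) + Suc ?BB) + 1"
          unfolding acost_bop_aexp acost.simps aval.simps s1' A_Suc[symmetric] using nb by linarith
        show "s1(''t'' := (s1 ''t'')(aval (Lit d) s1 :=
            aval (bop_aexp p (reg ''t'' d) (reg ''t'' (Suc (Suc d)))) s1))
          = s1(''t'' := (s1 ''t'')(d := A (Suc i)))"
          unfolding aval_bop_aexp aval.simps s1' A_Suc ..
        fix s2
        assume s2: "s2 = s1(''t'' := (s1 ''t'')(d := A (Suc i)))"
        then have v2: "s2 ''v'' = env(x := i)" using s1'(3) by simp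
        show "acost (Lit x) s2 + acost (Plus (reg ''v'' x) (Lit 1)) s2 + 1
          \<le> nbits x + (nbits x + Suc (Suc (k * W)) + nbits 1 + Suc (Suc (k * W))) + 1"
          unfolding acost.simps aval.simps v2 fun_upd_same using nb(4,5) by linarith
        show "J (Suc i) (s2(''v'' := (s2 ''v'')(aval (Lit x) s2 :=
            aval (Plus (reg ''v'' x) (Lit 1)) s2)))"
          unfolding J_def s2 using i s1' by simp
      qed
    qed
    with cost[OF J] J i show "bval (Less (reg ''v'' x) (len_power k)) s' \<and>
        bcost (Less (reg ''v'' x) (len_power k)) s' \<le> ?U \<and>
        runs (Seq (compile e (Suc (Suc d)))
            (Seq (put ''t'' d (bop_aexp p (reg ''t'' d) (reg ''t'' (Suc (Suc d)))))
                 (put ''v'' x (Plus (reg ''v'' x) (Lit 1))))) s' ?T (J (Suc i))"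
      unfolding bval.simps bcost.simps using Big.prems(1) by (simp add: J_def)
  next
    fix s'
    assume J: "J (inp 0 ^ k) s'"
    with cost[OF J] show "\<not> bval (Less (reg ''v'' x) (len_power k)) s' \<and>
        bcost (Less (reg ''v'' x) (len_power k)) s' \<le> ?U"
      unfolding bval.simps bcost.simps using Big.prems(1) by (simp add: J_def)
  next
    show "J 0 s'" using that .
    show "Suc (inp 0 ^ k) * (?U + ?T + 1) \<le> Suc (W ^ k) * (?U + ?T + 1)"
      using power_mono[OF len, of k] by (intro mult_right_mono) auto
  qed
  have V: "nbits (env x) \<le> Suc V" using Big.prems(2) by (auto simp: env_def intro: nbits_le)
  show ?case unfolding compile.simps steps.simps
    apply (rule runs_Seq[where Q = "\<lambda>s1. s1 = s(''t'' := (s ''t'')(d := c))"])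
     apply (rule runs_Assign)
      apply simp
     apply simp
    apply (rule runs_Seq[where
          Q = "\<lambda>s1. s1 = s(''t'' := (s ''t'')(d := c, Suc d := env x))"])
     apply (rule runs_Assign)
      apply (simp add: env_def)
    using V apply (simp add: env_def)
    apply (rule runs_Seq[where Q = "J 0"])
     apply (rule runs_Assign)
      apply (simp add: J_def env_def A_def)
     apply simp
    apply (rule runs_Seq[OF loop])
     apply assumption
    apply (rule runs_Assign)
    using V apply (auto simp: J_def env_def A_def)
    done
qed

section \<open>From expressions to a polynomial-time algorithm\<close>

lemma load_in_0 [simp]: "load ws ''in'' 0 = length ws"
  by (simp add: load_def)

text \<open>Each word costs at least 1, so the length, which drives all loops, is bounded by the
  input size. Thus \<open>W = word_size ws\<close> can play both roles of \<open>W\<close>.\<close>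

lemma length_le_word_size: "length ws \<le> word_size ws"
  using sum_list_mono[of ws "\<lambda>_. 1" nbits] le_nbits by (simp add: word_size_def sum_list_triv)

lemma load_less:
  shows "load ws ''in'' i < 2 ^ word_size ws"
proof -
  have "ws ! (i - 1) < 2 ^ word_size ws" if "i \<noteq> 0" "i \<le> length ws"
  proof -
    have "nbits (ws ! (i - 1)) \<le> word_size ws"
      unfolding word_size_def using that by (intro member_le_sum_list) auto
    then have "(2::nat) ^ nbits (ws ! (i - 1)) \<le> 2 ^ word_size ws" by simp
    with less_power_nbits[of "ws ! (i - 1)"] show ?thesis by linarith
  qed
  moreover have "length ws < 2 ^ word_size ws"
    using length_le_word_size[of ws] less_exp[of "word_size ws"] by linarith
  ultimately show ?thesis by (auto simp: load_def)
qed

text \<open>Each output entry is computed afresh from its position in variable 0, at the price of a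
  polynomial factor, so nothing has to be carried from one entry to the next. The loop always writes
  \<open>inp 0 ^ k\<close> entries; \<open>result\<close> ignores those beyond the computed
  length.\<close>

theorem solvable_by_expr:
  fixes len out :: expr and k :: nat
  assumes correct: "\<And>I. I \<in> D \<Longrightarrow>
      eval len (load (enc I) ''in'') (\<lambda>_. 0) \<le> length (enc I) ^ k \<and>
      R I (map (\<lambda>j. eval out (load (enc I) ''in'') ((\<lambda>_. 0)(0 := j)))
        [0..<eval len (load (enc I) ''in'') (\<lambda>_. 0)])"
  shows "solvable_in_polynomial_time enc D R"
proof -
  define body where "body = Seq (compile out 0)
    (Seq (Assign ''out'' (Plus (reg ''v'' 0) (Lit 1)) (reg ''t'' 0))
         (put ''v'' 0 (Plus (reg ''v'' 0) (Lit 1))))"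
  define cond where "cond = Less (reg ''v'' 0) (len_power k)"
  define prog where "prog = Seq (compile len 0) (Seq (put ''out'' 0 (reg ''t'' 0))
    (Seq (put ''v'' 0 (Lit 0)) (While cond body)))"
  define U where "U W = nbits 0 + Suc (Suc (k * W)) + len_power_cost k W + 1" for W
  define T where "T W = steps out 0 (Suc (k * W)) W +
    ((nbits 0 + Suc (Suc (k * W)) + nbits 1 + Suc (Suc (k * W))
        + (nbits 0 + Suc (bits out (Suc (k * W)) W)) + 1) +
     (nbits 0 + (nbits 0 + Suc (Suc (k * W)) + nbits 1 + Suc (Suc (k * W))) + 1) + 1) + 1" for W
  define total where "total W = steps len 0 1 W +
    ((nbits 0 + (nbits 0 + Suc (bits len 1 W)) + 1) +
     ((nbits 0 + nbits 0 + 1) + Suc (W ^ k) * (U W + T W + 1) + 1) + 1) + 1" for W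
  have "poly_bounded total"
    unfolding total_def U_def T_def
    by (intro poly_bounded_intros poly_bounded_steps poly_bounded_bits poly_bounded_len_power_cost)
  then obtain p where p: "\<And>W. total W \<le> poly p W" unfolding poly_bounded_def by blast
  have main: "runs prog (load ws) (total (word_size ws)) (\<lambda>s. \<forall>L. L \<le> length ws ^ k \<longrightarrow>
      L = eval len (load ws ''in'') (\<lambda>_. 0) \<longrightarrow>
      result s = map (\<lambda>j. eval out (load ws ''in'') ((\<lambda>_. 0)(0 := j))) [0..<L])" for ws
  proof -
    define inp where "inp = load ws ''in''"
    define W where "W = word_size ws"
    define L where "L = eval len inp (\<lambda>_. 0)"
    have inp: "inp i < 2 ^ W" for i unfolding inp_def W_def by (rule load_less)
    have len0: "inp 0 \<le> W" unfolding inp_def W_def by (simp add: length_le_word_size)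
    define g where "g j = eval out inp ((\<lambda>_. 0)(0 := j))" for j
    define J where "J i s \<longleftrightarrow> i \<le> inp 0 ^ k \<and> s ''in'' = inp \<and> s ''v'' = (\<lambda>_. 0)(0 := i) \<and>
      s ''out'' 0 = L \<and> (\<forall>j<i. s ''out'' (Suc j) = g j)" for i and s :: state
    have i_less: "i < 2 ^ Suc (k * W)" if "i \<le> inp 0 ^ k" for i
    proof -
      have "(0::nat) < 2 ^ (k * W)" by simp
      then show ?thesis unfolding power_Suc using that power_le_power2[OF inp, of 0 k] by linarith
    qed
    have env: "((\<lambda>_. 0)(0 := i)) y < (2::nat) ^ Suc (k * W)" if "i \<le> inp 0 ^ k" for i y :: nat
      using i_less[OF that] by simp
    have cost: "acost (reg ''v'' 0) s + acost (len_power k) s + 1 \<le> U W" if "J i s" for i s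
    proof -
      have "acost (len_power k) s \<le> len_power_cost k W"
        using that inp by (intro acost_len_power) (simp add: J_def)
      then show ?thesis using nbits_le[OF i_less, of i] that by (simp add: J_def U_def)
    qed
    have step: "runs body s (T W) (J (Suc i))" if i: "i < inp 0 ^ k" and J: "J i s" for i s
      unfolding body_def T_def
    proof (rule runs_Seq[OF runs_compile[of inp W, OF inp len0]])
      show "s ''in'' = inp" "s ''v'' y < 2 ^ Suc (k * W)" for y
        using J env[of i] i by (auto simp: J_def)
      fix s1
      assume "s1 ''t'' 0 = eval out inp (s ''v'') \<and> (\<forall>i<0. s1 ''t'' i = s ''t'' i) \<and>
        (\<forall>a. a \<noteq> ''t'' \<longrightarrow> s1 a = s a)"
      then have s1: "s1 ''t'' 0 = g i" "s1 ''in'' = inp" "s1 ''v'' = (\<lambda>_. 0)(0 := i)"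
          "s1 ''out'' 0 = L" "\<And>j. j < i \<Longrightarrow> s1 ''out'' (Suc j) = g j"
        using J by (auto simp: J_def g_def)
      have nb: "nbits i \<le> Suc (Suc (k * W))" "nbits (i + 1) \<le> Suc (Suc (k * W))"
        using i by (intro nbits_le i_less; simp)+
      have nbg: "nbits (g i) \<le> Suc (bits out (Suc (k * W)) W)"
        unfolding g_def using i
        by (intro nbits_le eval_less[of inp W, OF inp len0] env) simp
      show "runs (Seq (Assign ''out'' (Plus (reg ''v'' 0) (Lit 1)) (reg ''t'' 0))
           (put ''v'' 0 (Plus (reg ''v'' 0) (Lit 1)))) s1
         ((nbits 0 + Suc (Suc (k * W)) + nbits 1 + Suc (Suc (k * W))
            + (nbits 0 + Suc (bits out (Suc (k * W)) W)) + 1) +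
         (nbits 0 + (nbits 0 + Suc (Suc (k * W)) + nbits 1 + Suc (Suc (k * W))) + 1) + 1)
         (J (Suc i))"
      proof (rule runs_Seq[where Q = "\<lambda>s2. s2 = s1(''out'' := (s1 ''out'')(Suc i := g i))",
            OF runs_Assign runs_Assign])
        show "acost (Plus (reg ''v'' 0) (Lit 1)) s1 + acost (reg ''t'' 0) s1 + 1
          \<le> nbits 0 + Suc (Suc (k * W)) + nbits 1 + Suc (Suc (k * W))
            + (nbits 0 + Suc (bits out (Suc (k * W)) W)) + 1"
          unfolding acost.simps aval.simps s1 fun_upd_same using nb nbg by linarith
        show "s1(''out'' := (s1 ''out'')(aval (Plus (reg ''v'' 0) (Lit 1)) s1 := aval (reg ''t'' 0) s1))
          = s1(''out'' := (s1 ''out'')(Suc i := g i))"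
          by (simp add: s1)
        fix s2
        assume s2: "s2 = s1(''out'' := (s1 ''out'')(Suc i := g i))"
        then have v2: "s2 ''v'' = (\<lambda>_. 0)(0 := i)" using s1(3) by simp
        show "acost (Lit 0) s2 + acost (Plus (reg ''v'' 0) (Lit 1)) s2 + 1
          \<le> nbits 0 + (nbits 0 + Suc (Suc (k * W)) + nbits 1 + Suc (Suc (k * W))) + 1"
          unfolding acost.simps aval.simps v2 fun_upd_same using nb by linarith
        show "J (Suc i) (s2(''v'' := (s2 ''v'')(aval (Lit 0) s2 :=
            aval (Plus (reg ''v'' 0) (Lit 1)) s2)))"
          unfolding J_def s2 using i s1 by (auto simp: less_Suc_eq)
      qed
    qed
    have loop: "runs (While cond body) s (Suc (W ^ k) * (U W + T W + 1)) (J (inp 0 ^ k))"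
      if "J 0 s" for s
    proof (rule runs_mono[OF runs_While[where J = J and N = "inp 0 ^ k" and U = "U W" and T = "T W"]])
      fix i s'
      assume "i < inp 0 ^ k" "J i s'"
      then show "bval cond s' \<and> bcost cond s' \<le> U W \<and> runs body s' (T W) (J (Suc i))"
        using step cost unfolding cond_def bval.simps bcost.simps by (simp add: J_def)
    next
      fix s'
      assume "J (inp 0 ^ k) s'"
      then show "\<not> bval cond s' \<and> bcost cond s' \<le> U W"
        using cost unfolding cond_def bval.simps bcost.simps by (simp add: J_def)
    next
      show "J 0 s" using that .
      show "Suc (inp 0 ^ k) * (U W + T W + 1) \<le> Suc (W ^ k) * (U W + T W + 1)"
        using power_mono[OF len0, of k] by (intro mult_right_mono) auto
    qed
    have v0: "load ws ''v'' = (\<lambda>_. 0)" by (auto simp: load_def)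
    have L_less: "L < 2 ^ bits len 1 W"
      unfolding L_def by (intro eval_less[of inp W, OF inp len0]) simp
    have res: "result s = map (\<lambda>j. eval out inp ((\<lambda>_. 0)(0 := j))) [0..<L]"
      if "J (inp 0 ^ k) s" "L \<le> inp 0 ^ k" for s
    proof -
      have "result s = map (s ''out'') (map Suc [0..<L])"
        using that(1) by (simp add: result_def J_def map_Suc_upt)
      also have "\<dots> = map g [0..<L]" using that by (auto simp: J_def)
      finally show ?thesis by (simp add: g_def)
    qed
    have "runs prog (load ws) (total W) (J (inp 0 ^ k))"
      unfolding prog_def total_def
    proof (rule runs_Seq[OF runs_compile[of inp W, OF inp len0]])
      show "load ws ''in'' = inp" "load ws ''v'' y < 2 ^ 1" for y
        by (simp_all add: inp_def v0)
      fix s1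
      assume "s1 ''t'' 0 = eval len inp (load ws ''v'') \<and> (\<forall>i<0. s1 ''t'' i = load ws ''t'' i) \<and>
        (\<forall>a. a \<noteq> ''t'' \<longrightarrow> s1 a = load ws a)"
      then have s1: "s1 ''t'' 0 = L" "s1 ''in'' = inp" "s1 ''v'' = (\<lambda>_. 0)"
        by (auto simp: L_def inp_def v0)
      show "runs (Seq (put ''out'' 0 (reg ''t'' 0)) (Seq (put ''v'' 0 (Lit 0)) (While cond body))) s1
         ((nbits 0 + (nbits 0 + Suc (bits len 1 W)) + 1) +
          ((nbits 0 + nbits 0 + 1) + Suc (W ^ k) * (U W + T W + 1) + 1) + 1) (J (inp 0 ^ k))"
      proof (rule runs_Seq[where Q = "\<lambda>s2. s2 = s1(''out'' := (s1 ''out'')(0 := L))",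
            OF runs_Assign runs_Seq[where Q = "J 0", OF runs_Assign loop]])
        show "acost (Lit 0) s1 + acost (reg ''t'' 0) s1 + 1
            \<le> nbits 0 + (nbits 0 + Suc (bits len 1 W)) + 1"
          unfolding acost.simps aval.simps s1 using nbits_le[OF L_less] by linarith
      qed (simp_all add: s1 J_def)
    qed
    then show ?thesis
      unfolding W_def
      by (rule runs_mono) (use res in \<open>auto simp: L_def inp_def\<close>)
  qed
  show ?thesis
    unfolding solvable_in_polynomial_time_def
  proof (intro exI[of _ prog] exI[of _ p] ballI)
    fix I assume I: "I \<in> D"
    from main[of "enc I"] correct[OF I] obtain t s where
      "exec prog (load (enc I)) t s" "t \<le> total (word_size (enc I))" "R I (result s)"
      unfolding runs_def by metis
    then show "\<exists>t s. exec prog (load (enc I)) t s \<and> t \<le> poly p (word_size (enc I)) \<and> R I (result s)"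
      using p order_trans by blast
  qed
qed

subsection \<open>Violated configurations of a knapsack constraint\<close>

lemma obtain_max:
  fixes f :: "'a \<Rightarrow> 'b::linorder"
  assumes "finite A" "A \<noteq> {}"
  obtains y where "y \<in> A" "\<And>i. i \<in> A \<Longrightarrow> f i \<le> f y"
  using Max_in[of "f ` A"] Max_ge[of "f ` A"] assms by fastforce

lemma obtain_min:
  fixes f :: "'a \<Rightarrow> 'b::linorder"
  assumes "finite A" "A \<noteq> {}"
  obtains y where "y \<in> A" "\<And>i. i \<in> A \<Longrightarrow> f y \<le> f i"
  using Min_in[of "f ` A"] Min_le[of "f ` A"] assms by fastforce

text \<open>Orders the indices by weight, ties broken by index.\<close>

definition key :: "nat \<Rightarrow> (nat \<Rightarrow> nat) \<Rightarrow> nat \<Rightarrow> nat" where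
  "key n a i = a i * n + i"

lemma key_le_imp_le:
  assumes "key n a i \<le> key n a j" "j < n"
  shows "a i \<le> a j"
proof (rule ccontr)
  assume "\<not> a i \<le> a j"
  then have "Suc (a j) * n \<le> a i * n" by (intro mult_right_mono) auto
  then show False using assms by (simp add: key_def)
qed

lemma key_inj:
  assumes "key n a i = key n a j" "i < n" "j < n"
  shows "i = j"
proof -
  have "a i = a j" using assms key_le_imp_le[of n a i j] key_le_imp_le[of n a j i] by simp
  then show ?thesis using assms(1) by (simp add: key_def)
qed

text \<open>The configuration conditions for \<open>N = S\<close> in numerical form, and the
  inequality rearranged into one term \<open>x i + x t - 1\<close> per element. In this form,
  deleting elements with \<open>x i = 0\<close> means dropping nonpositive terms.\<close>

definition violated ::
    "nat \<Rightarrow> (nat \<Rightarrow> nat) \<Rightarrow> nat \<Rightarrow> (nat \<Rightarrow> real) \<Rightarrow> nat set \<Rightarrow> nat \<Rightarrow> nat \<Rightarrow> bool" where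
  "violated n a b x S t k \<longleftrightarrow> S \<subseteq> {..<n} \<and> t < n \<and> t \<notin> S \<and> 2 \<le> k \<and> k \<le> card S \<and> sum a S \<le> b \<and>
     (\<forall>Q\<subseteq>S. card Q = k \<longrightarrow> b < sum a Q + a t) \<and>
     (\<forall>Q\<subseteq>S. card Q = k - 1 \<longrightarrow> sum a Q + a t \<le> b) \<and>
     (real k - 1) * x t < (\<Sum>i\<in>S. x i + x t - 1)"

text \<open>\<open>u\<close> and \<open>z\<close> only mark the ends of an interval in the order by
  \<open>key\<close>; they may themselves be fractional.\<close>

definition candidate ::
    "nat \<Rightarrow> (nat \<Rightarrow> nat) \<Rightarrow> (nat \<Rightarrow> real) \<Rightarrow> nat \<Rightarrow> nat \<Rightarrow> nat \<Rightarrow> nat set \<Rightarrow> nat set \<Rightarrow> nat set" where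
  "candidate n a x t u z P R = {i. i < n \<and> i \<noteq> t \<and> i \<notin> R \<and>
     (i \<in> P \<or> x i = 1 \<and> key n a u \<le> key n a i \<and> key n a i \<le> key n a z)}"

text \<open>A single row in isolation: the other rows enter only through \<open>m\<close>, as a
  bound on the number of fractional coordinates.\<close>

locale knapsack_point =
  fixes n :: nat and a :: "nat \<Rightarrow> nat" and b :: nat and x :: "nat \<Rightarrow> real" and m :: nat
  assumes x_bounds: "\<And>i. i < n \<Longrightarrow> 0 \<le> x i \<and> x i \<le> 1"
    and feasible: "(\<Sum>i<n. a i * x i) \<le> b"
    and card_fractional: "card {i. i < n \<and> 0 < x i \<and> x i < 1} \<le> m"
begin

definition min_cover :: "nat set \<Rightarrow> bool" where
  "min_cover C \<longleftrightarrow> C \<subseteq> {..<n} \<and> b < sum a C \<and> (\<forall>j\<in>C. sum a (C - {j}) \<le> b)"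

lemma min_cover_exists:
  assumes "C \<subseteq> {..<n}" "b < sum a C"
  obtains D where "D \<subseteq> C" "min_cover D"
proof -
  have "finite C" using assms(1) finite_subset by blast
  then have "\<exists>D\<subseteq>C. min_cover D" using assms
  proof (induction C rule: finite_psubset_induct)
    case (psubset C)
    show ?case
    proof (cases "min_cover C")
      case False
      then obtain j where "j \<in> C" "b < sum a (C - {j})"
        using psubset.prems unfolding min_cover_def by force
      then show ?thesis using psubset.IH[of "C - {j}"] psubset.prems by blast
    qed blast
  qed
  then show ?thesis using that by blast
qed

text \<open>Ones contribute their full weight to a row that \<open>x\<close> satisfies.\<close>

lemma ones_fit:
  assumes "X \<subseteq> {..<n}" "\<And>i. i \<in> X \<Longrightarrow> x i = 1"
  shows "sum a X \<le> b"
proof -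
  have "real (sum a X) = (\<Sum>i\<in>X. a i * x i)" using assms(2) by simp
  also have "\<dots> \<le> (\<Sum>i<n. a i * x i)"
    using assms(1) x_bounds by (intro sum_mono2) auto
  finally show ?thesis using feasible by linarith
qed

text \<open>For \<open>k = |S|\<close> the configuration inequality is the cover inequality of \<open>S \<union> {t}\<close>.\<close>

lemma violated_of_min_cover:
  assumes C: "min_cover C" and card: "3 \<le> card C" and t: "t \<in> C" and gap: "(\<Sum>i\<in>C. 1 - x i) < 1"
  shows "violated n a b x (C - {t}) t (card C - 1)"
  unfolding violated_def
proof (intro conjI allI impI)
  have fin: "finite C" using C finite_subset unfolding min_cover_def by blast
  show "C - {t} \<subseteq> {..<n}" "t < n" "t \<notin> C - {t}" "sum a (C - {t}) \<le> b"
    using C t by (auto simp: min_cover_def)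
  show "2 \<le> card C - 1" "card C - 1 \<le> card (C - {t})" using card fin t by auto
  fix Q assume Q: "Q \<subseteq> C - {t}"
  {
    assume "card Q = card C - 1"
    then have "Q = C - {t}" using Q fin t by (intro card_subset_eq) auto
    then show "b < sum a Q + a t"
      using C fin t by (simp add: min_cover_def sum.remove add.commute)
  next
    assume "card Q = card C - 1 - 1"
    \<comment> \<open>\<open>Q\<close> misses some \<open>j\<close> of \<open>C - {t}\<close>, so
      \<open>Q \<union> {t}\<close> lies in \<open>C - {j}\<close>, which fits by
      minimality.\<close>
    then have "Q \<noteq> C - {t}" using fin t card by auto
    then obtain j where j: "j \<in> C" "j \<noteq> t" "j \<notin> Q" using Q by blast
    have "sum a Q + a t = sum a (insert t Q)" using Q fin finite_subset[OF Q] by (subst sum.insert) auto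
    also have "\<dots> \<le> sum a (C - {j})" using Q j t fin by (intro sum_mono2) auto
    also have "\<dots> \<le> b" using C j by (simp add: min_cover_def)
    finally show "sum a Q + a t \<le> b" .
  }
next
  have fin: "finite C" using C finite_subset unfolding min_cover_def by blast
  have "(\<Sum>i\<in>C. 1 - x i) = 1 - x t + (\<Sum>i\<in>C - {t}. 1 - x i)" using fin t by (rule sum.remove)
  moreover have "(\<Sum>i\<in>C - {t}. x i + x t - 1) = card (C - {t}) * x t - (\<Sum>i\<in>C - {t}. 1 - x i)"
    by (simp add: sum_subtractf sum.distrib algebra_simps)
  moreover have "card (C - {t}) = card C - 1" using fin t by simp
  moreover have "real (card C - 1) = real (card C) - 1" using card by linarith
  ultimately show "(real (card C - 1) - 1) * x t < (\<Sum>i\<in>C - {t}. x i + x t - 1)"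
    using gap by (simp add: algebra_simps)
qed

text \<open>Both constants come from the case without a suitable cover: there \<open>P\<close>
  consists of the fractional elements of \<open>S\<close> and its smallest element, and
  \<open>R\<close> of omitted ones counted by a comparison of weights.\<close>

definition has_candidate :: bool where
  "has_candidate \<longleftrightarrow> (\<exists>t k u z P R. t < n \<and> u < n \<and> z < n \<and> P \<subseteq> {..<n} \<and> R \<subseteq> {..<n} \<and>
     card P \<le> m + 1 \<and> card R \<le> 2 * m \<and> violated n a b x (candidate n a x t u z P R) t k)"

lemma has_candidateI:
  assumes "violated n a b x S t k" "candidate n a x t u z P R = S" "u < n" "z < n" "P \<subseteq> {..<n}"
    "R \<subseteq> {..<n}" "card P \<le> m + 1" "card R \<le> 2 * m"
  shows has_candidate
proof -
  have "t < n" using assms(1) by (simp add: violated_def)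
  then show ?thesis unfolding has_candidate_def using assms by metis
qed

text \<open>With the two largest elements of a minimal cover fixed, cover all the ones below them and
  discard smallest elements as long as a cover remains.\<close>

lemma candidate_of_min_cover:
  assumes C: "min_cover C" and card: "3 \<le> card C" and gap: "(\<Sum>i\<in>C. 1 - x i) < 1"
  shows has_candidate
proof -
  let ?key = "key n a"
  have Cn: "C \<subseteq> {..<n}" and fin: "finite C"
    using C finite_subset unfolding min_cover_def by blast+
  \<comment> \<open>A single coordinate 0 would already make the gap 1. So the elements of
    \<open>C\<close> below 1 are properly fractional, and there are at most \<open>m\<close> of
    them.\<close>
  have pos: "0 < x i" if "i \<in> C" for i
  proof -
    have "1 - x i \<le> (\<Sum>i\<in>C. 1 - x i)" using that fin Cn x_bounds by (intro member_le_sum) auto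
    then show ?thesis using gap by simp
  qed
  have "C \<noteq> {}" using card by auto
  then obtain y where y: "y \<in> C" "\<And>i. i \<in> C \<Longrightarrow> ?key i \<le> ?key y" using obtain_max[OF fin] by metis
  have "card (C - {y}) \<noteq> 0" using card fin y(1) by simp
  then have "C - {y} \<noteq> {}" by (metis card.empty)
  then obtain z where z: "z \<in> C - {y}" "\<And>i. i \<in> C - {y} \<Longrightarrow> ?key i \<le> ?key z"
    using obtain_max[of "C - {y}" ?key] fin by (metis finite_Diff)
  define F where "F = {i \<in> C. x i < 1}"
  \<comment> \<open>Ones add nothing to the gap, so all of them up to \<open>z\<close> can be
    included for free.\<close>
  define G where "G = insert y (F \<union> {i. i < n \<and> x i = 1 \<and> ?key i \<le> ?key z})"
  have Gn: "G \<subseteq> {..<n}" using Cn y(1) by (auto simp: G_def F_def)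
  then have finG: "finite G" using finite_subset by blast
  have CG: "C \<subseteq> G"
  proof
    fix i assume i: "i \<in> C"
    then have "i < n" "x i \<le> 1" using Cn x_bounds by auto
    then show "i \<in> G" using i z(2)[of i] by (auto simp: G_def F_def)
  qed
  have y_max: "?key i \<le> ?key y" if "i \<in> G" for i
    using that y(2)[of z] y(2)[of i] z(1) by (auto simp: G_def F_def)
  have z_max: "?key i \<le> ?key z" if "i \<in> G" "i \<noteq> y" for i
    using that z(2)[of i] by (auto simp: G_def F_def)
  have gapG: "(\<Sum>i\<in>G. 1 - x i) < 1"
  proof -
    have "(\<Sum>i\<in>G. 1 - x i) = (\<Sum>i\<in>C. 1 - x i)"
      using CG finG y(1) by (intro sum.mono_neutral_right) (auto simp: G_def F_def)
    then show ?thesis using gap by simp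
  qed
  \<comment> \<open>\<open>U w\<close> is an upper set of \<open>G\<close>, and \<open>u\<close>
    below is the last \<open>w\<close> for which it still covers. Then dropping \<open>u\<close>
    uncovers, and so does dropping any other element, as it is at least as heavy.\<close>
  define U where "U w = {i \<in> G. ?key w \<le> ?key i}" for w
  define Ws where "Ws = {w \<in> G. b < sum a (U w)}"
  have "G \<noteq> {}" by (simp add: G_def)
  then obtain w0 where w0: "w0 \<in> G" "\<And>i. i \<in> G \<Longrightarrow> ?key w0 \<le> ?key i"
    using obtain_min[OF finG] by metis
  have "U w0 = G" using w0 by (auto simp: U_def)
  moreover have "b < sum a G"
  proof -
    have "b < sum a C" using C by (simp add: min_cover_def)
    also have "\<dots> \<le> sum a G" using CG finG by (intro sum_mono2) auto
    finally show ?thesis .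
  qed
  ultimately have "Ws \<noteq> {}" using w0(1) by (auto simp: Ws_def)
  moreover have "finite Ws" using finG by (simp add: Ws_def)
  ultimately obtain u where u: "u \<in> Ws" "\<And>i. i \<in> Ws \<Longrightarrow> ?key i \<le> ?key u"
    using obtain_max by metis
  define D where "D = U u"
  have DG: "D \<subseteq> G" and uD: "u \<in> D" and uG: "u \<in> G" and bD: "b < sum a D"
    using u(1) by (auto simp: D_def U_def Ws_def)
  have finD: "finite D" using DG finG finite_subset by blast
  have "sum a (D - {u}) \<le> b"
  proof (cases "D - {u} = {}")
    case False
    \<comment> \<open>\<open>w\<close> is the successor of \<open>u\<close> in \<open>D\<close>, so
      \<open>D - {u}\<close> is \<open>U w\<close>, which is no cover by the choice of
      \<open>u\<close>.\<close>
    then obtain w where w: "w \<in> D - {u}" "\<And>i. i \<in> D - {u} \<Longrightarrow> ?key w \<le> ?key i"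
      using obtain_min[of "D - {u}" ?key] finD by (metis finite_Diff)
    have "?key w \<noteq> ?key u" using key_inj[of n a w u] w(1) uG DG Gn by auto
    then have "?key u < ?key w" using w(1) by (auto simp: D_def U_def)
    then have "D - {u} = U w" using w DG by (auto simp: D_def U_def)
    moreover have "w \<notin> Ws" using u(2)[of w] \<open>?key u < ?key w\<close> by auto
    ultimately show ?thesis using w(1) DG by (auto simp: Ws_def)
  qed (metis sum.empty zero_le)
  have D: "min_cover D"
    unfolding min_cover_def
  proof (intro conjI ballI)
    show "D \<subseteq> {..<n}" "b < sum a D" using DG Gn bD by auto
    fix j assume j: "j \<in> D"
    then have "a u \<le> a j" using key_le_imp_le[of n a u j] DG Gn by (auto simp: D_def U_def)
    moreover have "sum a D = a j + sum a (D - {j})" "sum a D = a u + sum a (D - {u})"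
      using finD j uD by (auto intro: sum.remove)
    ultimately show "sum a (D - {j}) \<le> b" using \<open>sum a (D - {u}) \<le> b\<close> by linarith
  qed
  have yD: "y \<in> D" using y_max[OF uG] by (simp add: D_def U_def G_def)
  have "3 \<le> card D"
  proof (rule ccontr)
    assume small: "\<not> 3 \<le> card D"
    \<comment> \<open>\<open>y\<close> and \<open>z\<close> are the two largest elements of
      \<open>G\<close>, so an upper set of fewer than three elements lies in \<open>{y, z}\<close>.
      But this pair omits a third element of the minimal cover \<open>C\<close> and hence
      fits.\<close>
    have "D \<subseteq> {y, z}"
    proof (rule ccontr)
      assume "\<not> D \<subseteq> {y, z}"
      then obtain j where j: "j \<in> D" "j \<noteq> y" "j \<noteq> z" by blast
      then have "?key j \<le> ?key z" using z_max DG by blast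
      then have "z \<in> D" using j(1) z(1) CG by (auto simp: D_def U_def)
      then have "card {j, y, z} \<le> card D" using j(1) yD finD by (intro card_mono) auto
      moreover have "card {j, y, z} = 3" using j z(1) by auto
      ultimately show False using small by simp
    qed
    then have "sum a D \<le> sum a {y, z}" by (intro sum_mono2) auto
    also have "\<dots> \<le> b"
    proof -
      have "\<not> C \<subseteq> {y, z}" using card card_mono[of "{y, z}" C] card_insert_le_m1[of 2 "{z}" y]
        by (auto simp: card_insert_if split: if_splits)
      then obtain j where j: "j \<in> C" "j \<noteq> y" "j \<noteq> z" by blast
      then have "sum a {y, z} \<le> sum a (C - {j})"
        using y z fin by (intro sum_mono2) auto
      also have "\<dots> \<le> b" using C j by (simp add: min_cover_def)
      finally show ?thesis .
    qed
    finally show False using bD by simp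
  qed
  moreover have "(\<Sum>i\<in>D. 1 - x i) < 1"
  proof -
    have "(\<Sum>i\<in>D. 1 - x i) \<le> (\<Sum>i\<in>G. 1 - x i)"
      using DG finG Gn x_bounds by (intro sum_mono2) auto
    then show ?thesis using gapG by simp
  qed
  ultimately have viol: "violated n a b x (D - {y}) y (card D - 1)"
    using violated_of_min_cover[OF D] yD by blast
  define P where "P = {i \<in> F. i \<noteq> y \<and> ?key u \<le> ?key i}"
  have "candidate n a x y u z P {} = D - {y}"
    using Cn Gn by (auto simp: candidate_def D_def U_def G_def P_def F_def)
  moreover have "card P \<le> m"
  proof -
    have "card P \<le> card {i. i < n \<and> 0 < x i \<and> x i < 1}"
      using pos Cn by (intro card_mono) (auto simp: P_def F_def)
    then show ?thesis using card_fractional by simp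
  qed
  moreover have "P \<subseteq> {..<n}" "y < n" "u < n" "z < n"
    using Cn Gn y(1) z(1) uG by (auto simp: P_def F_def)
  ultimately show ?thesis
    using has_candidateI[OF viol, of u z P "{}"] by simp
qed

text \<open>Without a violated minimal cover inequality the ones not exceeding the capacity together with
  \<open>t\<close> fit in jointly with \<open>t\<close>, so \<open>S\<close> can miss only a few of those between its second smallest and
  its largest element: their weights differ by a factor of at most two.\<close>

lemma candidate_of_violated:
  assumes viol: "violated n a b x S0 t k"
  shows has_candidate
proof (cases "\<exists>C. min_cover C \<and> 3 \<le> card C \<and> (\<Sum>i\<in>C. 1 - x i) < 1")
  case True
  then show ?thesis using candidate_of_min_cover by blast
next
  case no_cover: False
  let ?key = "key n a"
  define S where "S = {i \<in> S0. 0 < x i}"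
  have t: "t < n" "t \<notin> S" "0 \<le> x t" "x t \<le> 1" and k: "2 \<le> k" and Sn: "S \<subseteq> {..<n}" and SS0: "S \<subseteq> S0"
    and finS0: "finite S0" and S0n: "S0 \<subseteq> {..<n}"
    using viol x_bounds by (auto simp: violated_def S_def intro: finite_subset)
  have finS: "finite S" using SS0 finS0 finite_subset by blast
  have up: "b < sum a Q + a t" if "Q \<subseteq> S" "card Q = k" for Q
    using viol that SS0 unfolding violated_def by blast
  have low: "sum a Q + a t \<le> b" if "Q \<subseteq> S" "card Q = k - 1" for Q
    using viol that SS0 unfolding violated_def by blast
  have sumS: "sum a S \<le> b"
    using viol sum_mono2[OF finS0 SS0, of a] unfolding violated_def by simp
  \<comment> \<open>An element with \<open>x i = 0\<close> contributes
    \<open>x t - 1 \<le> 0\<close>, so the violation survives its removal.\<close>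
  have gap: "(real k - 1) * x t < (\<Sum>i\<in>S. x i + x t - 1)"
  proof -
    have "(\<Sum>i\<in>S0. x i + x t - 1) = (\<Sum>i\<in>S. x i + x t - 1) + (\<Sum>i\<in>S0 - S. x i + x t - 1)"
      using finS0 SS0 by (simp add: sum.subset_diff)
    moreover have "(\<Sum>i\<in>S0 - S. x i + x t - 1) \<le> 0"
    proof (rule sum_nonpos)
      fix i assume i: "i \<in> S0 - S"
      then have "x i = 0" using x_bounds[of i] S0n by (force simp: S_def)
      then show "x i + x t - 1 \<le> 0" using t by simp
    qed
    moreover have "(real k - 1) * x t < (\<Sum>i\<in>S0. x i + x t - 1)"
      using viol by (simp add: violated_def)
    ultimately show ?thesis by linarith
  qed
  have gap_le: "(\<Sum>i\<in>S. x i + x t - 1) \<le> card S * x t"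
  proof -
    have "(\<Sum>i\<in>S. x i + x t - 1) \<le> (\<Sum>i\<in>S. x t)" using Sn x_bounds by (intro sum_mono) force
    then show ?thesis by simp
  qed
  have xt: "0 < x t"
    using gap gap_le t(3) by (cases "x t = 0") auto
  \<comment> \<open>Each term of the violation is at most \<open>x t\<close>, so more than
    \<open>k - 1\<close> of them are left after the zeros are dropped.\<close>
  have cardS: "k \<le> card S"
  proof -
    have "(real k - 1) * x t < card S * x t" using gap gap_le by linarith
    then show ?thesis using xt by simp
  qed
  define T where "T = {i \<in> S. x i = 1}"
  define F where "F = {i \<in> S. x i < 1}"
  have TF: "S = T \<union> F" "T \<inter> F = {}" using x_bounds Sn by (force simp: T_def F_def)+
  have finTF: "finite T" "finite F" using finS by (auto simp: T_def F_def)
  have cardTF: "card S = card T + card F" using TF finTF by (simp add: card_Un_disjoint)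
  have cardF: "card F \<le> m"
  proof -
    have "card F \<le> card {i. i < n \<and> 0 < x i \<and> x i < 1}"
      using Sn by (intro card_mono) (auto simp: F_def S_def)
    then show ?thesis using card_fractional by simp
  qed
  have min_cover_insert: "min_cover (insert t Q)" if Q: "Q \<subseteq> S" "card Q = k" for Q
  proof -
    have finQ: "finite Q" and tQ: "t \<notin> Q" using finite_subset Q finS t by auto
    have "sum a (insert t Q - {j}) \<le> b" if j: "j \<in> insert t Q" for j
    proof (cases "j = t")
      case True
      have "sum a Q \<le> sum a S" using Q finS by (intro sum_mono2) auto
      moreover have "insert t Q - {j} = Q" using True tQ by auto
      ultimately show ?thesis using sumS by simp
    next
      case False
      then have "insert t Q - {j} = insert t (Q - {j})" by auto
      moreover have "sum a (Q - {j}) + a t \<le> b"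
        using False j Q finQ by (intro low) auto
      ultimately show ?thesis using finQ tQ by simp
    qed
    then show ?thesis
      using up[OF Q] Q Sn t finQ tQ unfolding min_cover_def by auto
  qed
  \<comment> \<open>As \<open>k \<ge> 2\<close>, any \<open>i\<close> extends to a subset of size
    \<open>k - 1\<close>, which fits together with \<open>t\<close>.\<close>
  have pair_fits: "a i + a t \<le> b" if "i \<in> S" for i
  proof -
    have "k - 2 \<le> card (S - {i})" using cardS that finS by simp
    then obtain Q where Q: "Q \<subseteq> S - {i}" "card Q = k - 2" using obtain_subset_with_card_n by metis
    have finQ: "finite Q" using Q(1) finS finite_subset by blast
    have iQ: "i \<notin> Q" using Q(1) by blast
    have "sum a (insert i Q) + a t \<le> b"
      using Q finQ iQ that k by (intro low) (auto simp: card_insert_disjoint)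
    then show ?thesis using iQ finQ by simp
  qed
  \<comment> \<open>For \<open>card S = k\<close> the inequality is the cover inequality of
    \<open>S \<union> {t}\<close>, whose violation is excluded in this case.\<close>
  have card_ne: "card S \<noteq> k"
  proof
    assume eq: "card S = k"
    have "(\<Sum>i\<in>S. x i + x t - 1) = card S * x t - (\<Sum>i\<in>S. 1 - x i)"
      by (simp add: sum_subtractf sum.distrib algebra_simps)
    then have "(\<Sum>i\<in>insert t S. 1 - x i) < 1"
      using gap eq finS t by (simp add: algebra_simps)
    moreover have "3 \<le> card (insert t S)" using eq finS t k by simp
    ultimately show False using no_cover min_cover_insert[OF order_refl eq] by blast
  qed
  \<comment> \<open>\<open>k\<close> ones from \<open>S\<close> would form with \<open>t\<close> a
    minimal cover of gap \<open>1 - x t\<close>, which is below 1.\<close>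
  have cardT: "card T < k"
  proof (rule ccontr)
    assume "\<not> card T < k"
    then obtain Q where Q: "Q \<subseteq> T" "card Q = k" using obtain_subset_with_card_n by (metis not_less)
    have finQ: "finite Q" and tQ: "t \<notin> Q" and QS: "Q \<subseteq> S"
      using Q(1) finTF t finite_subset by (auto simp: T_def)
    have "(\<Sum>i\<in>Q. 1 - x i) = 0" using Q(1) by (intro sum.neutral) (auto simp: T_def)
    then have "(\<Sum>i\<in>insert t Q. 1 - x i) < 1"
      using xt finQ tQ by simp
    moreover have "3 \<le> card (insert t Q)" using Q finQ tQ k by simp
    ultimately show False using no_cover min_cover_insert[OF QS Q(2)] by blast
  qed
  define O' where "O' = {i. i < n \<and> i \<noteq> t \<and> x i = 1 \<and> a i + a t \<le> b}"
  have finO: "finite O'" and tO: "t \<notin> O'" by (auto simp: O'_def)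
  \<comment> \<open>Otherwise \<open>O' \<union> {t}\<close> contains a minimal cover. It contains
    \<open>t\<close>, because ones alone fit; it has at least three elements, because
    \<open>t\<close> alone and each pair with \<open>t\<close> fit; and its gap is
    \<open>1 - x t < 1\<close>.\<close>
  have O_fits: "sum a O' + a t \<le> b"
  proof (rule ccontr)
    assume "\<not> sum a O' + a t \<le> b"
    then have "b < sum a (insert t O')" using finO tO by simp
    moreover have "insert t O' \<subseteq> {..<n}" using t by (auto simp: O'_def)
    ultimately obtain C where C: "C \<subseteq> insert t O'" "min_cover C" using min_cover_exists by metis
    have bC: "b < sum a C" and finC: "finite C" 
      using C finO finite_subset unfolding min_cover_def by blast+
    have tC: "t \<in> C"
    proof (rule ccontr)
      assume "t \<notin> C"
      then have "sum a C \<le> b" using C(1) by (intro ones_fit) (auto simp: O'_def)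
      then show False using bC by simp
    qed
    have sumC: "sum a C = a t + sum a (C - {t})" using finC tC by (rule sum.remove)
    have "2 \<le> card (C - {t})"
    proof (rule ccontr)
      assume "\<not> 2 \<le> card (C - {t})"
      then consider "card (C - {t}) = 0" | "card (C - {t}) = 1" by linarith
      then show False
      proof cases
        case 1
        then have "C - {t} = {}" using finC by simp
        then have "b < a t" using sumC bC by (metis add.right_neutral sum.empty)
        moreover obtain i where "i \<in> S" using cardS k by fastforce
        ultimately show False using pair_fits[of i] by simp
      next
        case 2
        then obtain i where i: "C - {t} = {i}" using card_1_singletonE by blast
        then have "i \<in> O'" using C(1) by auto
        then have "sum a C \<le> b" using sumC i by (simp add: O'_def)
        then show False using bC by simp
      qed
    qed
    then have "3 \<le> card C" using finC tC by simp
    moreover have "(\<Sum>i\<in>C. 1 - x i) < 1"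
    proof -
      have "(\<Sum>i\<in>C. 1 - x i) = 1 - x t + (\<Sum>i\<in>C - {t}. 1 - x i)" using finC tC by (rule sum.remove)
      moreover have "(\<Sum>i\<in>C - {t}. 1 - x i) = 0"
        using C(1) by (intro sum.neutral) (auto simp: O'_def)
      ultimately show ?thesis using xt by simp
    qed
    ultimately show False using no_cover C(2) by blast
  qed
  have "S \<noteq> {}" using cardS k by auto
  then obtain s where s: "s \<in> S" "\<And>i. i \<in> S \<Longrightarrow> ?key s \<le> ?key i" using obtain_min[OF finS] by metis
  have cS: "card (S - {s}) \<ge> 2" using s finS cardS card_ne k by simp
  then have "S - {s} \<noteq> {}" by force
  then obtain u where u: "u \<in> S - {s}" "\<And>i. i \<in> S - {s} \<Longrightarrow> ?key u \<le> ?key i"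
    using obtain_min[of "S - {s}" ?key] finS by (metis finite_Diff)
  have "card (S - {s} - {u}) \<ge> 1" using cS u finS by simp
  then have "S - {s} - {u} \<noteq> {}" by force
  then obtain z where z: "z \<in> S - {s} - {u}" "\<And>i. i \<in> S - {s} - {u} \<Longrightarrow> ?key i \<le> ?key z"
    using obtain_max[of "S - {s} - {u}" ?key] finS by (metis finite_Diff)
  have zmax: "?key i \<le> ?key z" if "i \<in> S" for i
    using z(2)[of i] s(2)[of z] u(2)[of z] z(1) that by (cases "i = s"; cases "i = u") auto
  \<comment> \<open>Take \<open>k - 2\<close> further elements \<open>M\<close>, which exist because
    \<open>card S > k\<close>. With \<open>t\<close>, the set \<open>{s, u} \<union> M\<close>
    overflows while \<open>{z} \<union> M\<close> fits, so
    \<open>a z < a s + a u \<le> 2 * a u\<close>. Nothing of the kind holds for \<open>s\<close>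
    alone, so the interval starts at \<open>u\<close>.\<close>
  have a_ratio: "a z < 2 * a u"
  proof -
    have "card (S - {s} - {u} - {z}) = card S - 3" using s u z finS by simp
    then have "k - 2 \<le> card (S - {s} - {u} - {z})" using cardS card_ne k by simp
    then obtain M where M: "M \<subseteq> S - {s} - {u} - {z}" "card M = k - 2"
      using obtain_subset_with_card_n by metis
    have finM: "finite M" using M(1) finS by (meson finite_Diff finite_subset)
    have MS: "M \<subseteq> S" and sM: "s \<notin> insert u M" and uM: "u \<notin> M" and zM: "z \<notin> M"
      using M(1) u(1) by auto
    have "b < sum a (insert s (insert u M)) + a t"
      using M(2) MS s(1) u(1) sM uM finM k by (intro up) (auto simp: card_insert_disjoint)
    moreover have "sum a (insert z M) + a t \<le> b"
      using M(2) MS z(1) zM finM k by (intro low) (auto simp: card_insert_disjoint)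
    moreover have "sum a (insert s (insert u M)) = a s + (a u + sum a M)"
      using sM uM finM by simp
    moreover have "sum a (insert z M) = a z + sum a M"
      using zM finM by simp
    moreover have "a s \<le> a u" using key_le_imp_le s(2)[of u] u(1) Sn by auto
    ultimately show ?thesis by linarith
  qed
  define R where "R = {i. i < n \<and> i \<noteq> t \<and> x i = 1 \<and> ?key u \<le> ?key i \<and> ?key i \<le> ?key z} - S"
  have finR: "finite R" by (simp add: R_def)
  have az: "a i \<le> a z" if "?key i \<le> ?key z" for i
    using that z(1) Sn key_le_imp_le by auto
  have RT: "R \<inter> T = {}" by (auto simp: R_def T_def)
  \<comment> \<open>No weight here exceeds \<open>a z\<close>, and \<open>z\<close> fits next to
    \<open>t\<close>.\<close>
  have "R \<union> T \<subseteq> O'"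
  proof
    fix i assume "i \<in> R \<union> T"
    then have "i < n" "i \<noteq> t" "x i = 1" "?key i \<le> ?key z"
      using Sn t zmax by (auto simp: R_def T_def)
    moreover have "a i + a t \<le> b" using az[OF \<open>?key i \<le> ?key z\<close>] pair_fits[of z] z(1) by auto
    ultimately show "i \<in> O'" by (simp add: O'_def)
  qed
  then have "sum a (R \<union> T) \<le> sum a O'" using finO by (intro sum_mono2) auto
  then have RT_fits: "sum a R + sum a T + a t \<le> b"
    using O_fits RT finR finTF by (simp add: sum.union_disjoint)
  \<comment> \<open>\<open>F0\<close> completes \<open>T\<close> to \<open>k\<close> elements, which
    overflow with \<open>t\<close>, whereas \<open>R\<close>, \<open>T\<close> and \<open>t\<close>
    fit together. Hence \<open>R\<close> weighs less than \<open>F0\<close>, that is, than at most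
    \<open>m\<close> elements of weight below \<open>2 * a u\<close>; and each element of
    \<open>R\<close> weighs at least \<open>a u\<close>.\<close>
  have "k - card T \<le> card F" using cardTF cardS by simp
  then obtain F0 where F0: "F0 \<subseteq> F" "card F0 = k - card T" using obtain_subset_with_card_n by metis
  have finF0: "finite F0" using F0(1) finTF finite_subset by blast
  have disj: "T \<inter> F0 = {}" using F0(1) TF by auto
  have "b < sum a (T \<union> F0) + a t"
    using F0 TF finTF finF0 disj cardT by (intro up) (auto simp: card_Un_disjoint)
  then have "sum a R < sum a F0"
    using RT_fits disj finTF finF0 by (simp add: sum.union_disjoint)
  also have "sum a F0 \<le> card F0 * a z"
    using F0(1) TF zmax az sum_bounded_above[of F0 a "a z"] by auto
  also have "\<dots> \<le> m * (2 * a u)"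
  proof (rule mult_le_mono)
    show "card F0 \<le> m" using cardF card_mono[OF finTF(2) F0(1)] by linarith
    show "a z \<le> 2 * a u" using a_ratio by simp
  qed
  finally have "sum a R < 2 * m * a u" by simp
  moreover have "card R * a u \<le> sum a R"
  proof -
    have "a u \<le> a i" if "i \<in> R" for i
      using that key_le_imp_le[of n a u i] unfolding R_def by blast
    from sum_bounded_below[of R "a u" a, OF this] show ?thesis by simp
  qed
  ultimately have "card R * a u < 2 * m * a u" by linarith
  then have cardR: "card R \<le> 2 * m" by simp
  \<comment> \<open>\<open>s\<close> may be a one lying below the interval, so it is listed
    explicitly.\<close>
  define P where "P = insert s F"
  have "card P \<le> m + 1" using cardF finTF by (simp add: P_def card_insert_if)
  moreover have "candidate n a x t u z P R = S"
  proof
    show "candidate n a x t u z P R \<subseteq> S"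
      using s(1) TF(1) unfolding candidate_def P_def R_def by blast
    show "S \<subseteq> candidate n a x t u z P R"
    proof
      fix i assume i: "i \<in> S"
      then have "i \<in> P \<or> x i = 1 \<and> ?key u \<le> ?key i \<and> ?key i \<le> ?key z"
        using TF(1) u(2)[of i] zmax[OF i] unfolding P_def T_def by blast
      then show "i \<in> candidate n a x t u z P R"
        using i Sn t(2) unfolding candidate_def R_def by blast
    qed
  qed
  moreover have "violated n a b x S t k"
    unfolding violated_def using Sn t k cardS sumS up low gap by blast
  moreover have "P \<subseteq> {..<n}" "R \<subseteq> {..<n}" "u < n" "z < n"
    using Sn s(1) u(1) z(1) by (auto simp: P_def F_def R_def)
  ultimately show ?thesis
    using has_candidateI cardR by blast
qed

end

subsection \<open>Extreme points and the numerical test\<close>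

lemma homogeneous_solution:
  fixes c :: "nat \<Rightarrow> 'a \<Rightarrow> real"
  assumes "finite F" "m < card F"
  shows "\<exists>y. (\<forall>i. i \<notin> F \<longrightarrow> y i = 0) \<and> (\<exists>i\<in>F. y i \<noteq> 0) \<and> (\<forall>r<m. (\<Sum>i\<in>F. c r i * y i) = 0)"
  using assms
proof (induction m arbitrary: c F)
  case 0
  then obtain p where "p \<in> F" by fastforce
  then show ?case by (intro exI[of _ "\<lambda>i. if i = p then 1 else 0"]) auto
next
  case (Suc m)
  show ?case
  proof (cases "\<forall>i\<in>F. c m i = 0")
    case True
    from Suc.IH[of F c] Suc.prems obtain y where
      y: "\<forall>i. i \<notin> F \<longrightarrow> y i = 0" "\<exists>i\<in>F. y i \<noteq> 0" "\<forall>r<m. (\<Sum>i\<in>F. c r i * y i) = 0"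
      by (auto dest: Suc_lessD)
    moreover have "(\<Sum>i\<in>F. c m i * y i) = 0" using True by simp
    ultimately have "\<forall>r<Suc m. (\<Sum>i\<in>F. c r i * y i) = 0" by (auto simp: less_Suc_eq)
    with y(1,2) show ?thesis by blast
  next
    case False
    then obtain p where p: "p \<in> F" "c m p \<noteq> 0" by blast
    \<comment> \<open>Gaussian elimination: equation \<open>m\<close> is solved for the unknown
      \<open>p\<close> and substituted into the others; \<open>w\<close> below is the back
      substitution. Indexing the unknowns by a set allows \<open>p\<close> to be removed without
      renumbering.\<close>
    define c' where "c' r i = c r i - c r p * c m i / c m p" for r i
    have "m < card (F - {p})" using Suc.prems p(1) by simp
    from Suc.IH[of "F - {p}" c'] this Suc.prems(1) obtain y where
      y: "\<forall>i. i \<notin> F - {p} \<longrightarrow> y i = 0" "\<exists>i\<in>F - {p}. y i \<noteq> 0"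
      "\<forall>r<m. (\<Sum>i\<in>F - {p}. c' r i * y i) = 0" by auto
    define w where "w = - (\<Sum>i\<in>F - {p}. c m i * y i) / c m p"
    define y' where "y' = y(p := w)"
    have row: "(\<Sum>i\<in>F. c r i * y' i) = c r p * w + (\<Sum>i\<in>F - {p}. c r i * y i)" for r
    proof -
      have "(\<Sum>i\<in>F. c r i * y' i) = c r p * y' p + (\<Sum>i\<in>F - {p}. c r i * y' i)"
        using Suc.prems(1) p(1) by (rule sum.remove)
      also have "(\<Sum>i\<in>F - {p}. c r i * y' i) = (\<Sum>i\<in>F - {p}. c r i * y i)"
        by (rule sum.cong) (auto simp: y'_def)
      finally show ?thesis by (simp add: y'_def)
    qed
    have "(\<Sum>i\<in>F. c r i * y' i) = 0" if "r < Suc m" for r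
    proof (cases "r = m")
      case True
      then show ?thesis using row[of m] p(2) by (simp add: w_def)
    next
      case False
      have "(\<Sum>i\<in>F - {p}. c' r i * y i)
          = (\<Sum>i\<in>F - {p}. c r i * y i) - c r p / c m p * (\<Sum>i\<in>F - {p}. c m i * y i)"
        by (simp add: c'_def sum_subtractf sum_distrib_left algebra_simps)
      then show ?thesis using row[of r] y(3) False that by (auto simp: w_def)
    qed
    moreover have "\<forall>i. i \<notin> F \<longrightarrow> y' i = 0" using y(1) p(1) by (auto simp: y'_def)
    moreover have "\<exists>i\<in>F. y' i \<noteq> 0" using y(2) by (auto simp: y'_def)
    ultimately show ?thesis by blast
  qed
qed

lemma polytope_iff:
  assumes "d \<in> carrier_vec (dim_row A)"
  shows "x \<in> polytope A d \<longleftrightarrow> dim_vec x = dim_col A \<and>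
    (\<forall>r<dim_row A. (\<Sum>i<dim_col A. real (A $$ (r, i)) * x $ i) \<le> d $ r) \<and>
    (\<forall>i<dim_col A. 0 \<le> x $ i \<and> x $ i \<le> 1)"
proof -
  have "map_mat real A *\<^sub>v x \<le> map_vec real d \<longleftrightarrow>
      (\<forall>r<dim_row A. (\<Sum>i<dim_col A. real (A $$ (r, i)) * x $ i) \<le> d $ r)"
    if "dim_vec x = dim_col A"
    using assms that by (simp add: less_eq_vec_def scalar_prod_def atLeast0LessThan)
  then show ?thesis unfolding polytope_def carrier_vec_def by blast
qed

text \<open>More fractional coordinates than rows leave a nonzero direction supported on them that
  every row annihilates. Small steps in both directions stay feasible, and \<open>x\<close> is their
  midpoint.\<close>

lemma extreme_point_card_fractional:
  assumes d: "d \<in> carrier_vec (dim_row A)" and ext: "extreme_point x (polytope A d)"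
  shows "card {i. i < dim_col A \<and> 0 < x $ i \<and> x $ i < 1} \<le> dim_row A"
proof (rule ccontr)
  define n where "n = dim_col A"
  define F where "F = {i. i < n \<and> 0 < x $ i \<and> x $ i < 1}"
  have Fn: "F \<subseteq> {..<n}" and finF: "finite F" by (auto simp: F_def)
  assume "\<not> card {i. i < dim_col A \<and> 0 < x $ i \<and> x $ i < 1} \<le> dim_row A"
  then have "dim_row A < card F" by (simp add: F_def n_def)
  from homogeneous_solution[OF finF this, of "\<lambda>r i. real (A $$ (r, i))"]
  obtain y where y: "\<And>i. i \<notin> F \<Longrightarrow> y i = 0" "\<exists>i\<in>F. y i \<noteq> 0"
    "\<And>r. r < dim_row A \<Longrightarrow> (\<Sum>i\<in>F. real (A $$ (r, i)) * y i) = 0" by blast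
  have x: "dim_vec x = n" "\<And>r. r < dim_row A \<Longrightarrow> (\<Sum>i<n. real (A $$ (r, i)) * x $ i) \<le> d $ r"
    "\<And>i. i < n \<Longrightarrow> 0 \<le> x $ i \<and> x $ i \<le> 1"
    using ext polytope_iff[OF d] by (auto simp: extreme_point_def n_def)
  have yn: "(\<Sum>i<n. real (A $$ (r, i)) * y i) = 0" if "r < dim_row A" for r
  proof -
    have "(\<Sum>i<n. real (A $$ (r, i)) * y i) = (\<Sum>i\<in>F. real (A $$ (r, i)) * y i)"
      using Fn y(1) by (intro sum.mono_neutral_right) auto
    then show ?thesis using y(3)[OF that] by simp
  qed
  \<comment> \<open>The room that every fractional coordinate has towards both 0 and 1.\<close>
  define mu where "mu = Min ((\<lambda>i. min (x $ i) (1 - x $ i)) ` F)"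
  have Fne: "F \<noteq> {}" using y(2) by blast
  have mu: "0 < mu" "\<And>i. i \<in> F \<Longrightarrow> mu \<le> x $ i \<and> mu \<le> 1 - x $ i"
  proof -
    show "0 < mu" unfolding mu_def using finF Fne by (subst Min_gr_iff) (auto simp: F_def)
    fix i assume "i \<in> F"
    then have "mu \<le> min (x $ i) (1 - x $ i)" unfolding mu_def using finF by (intro Min_le) auto
    then show "mu \<le> x $ i \<and> mu \<le> 1 - x $ i" by simp
  qed
  \<comment> \<open>Dividing by the sum, which dominates each \<open>\<bar>y i\<bar>\<close>, keeps
    every step \<open>e * y i\<close> within \<open>mu\<close>.\<close>
  define e where "e = mu / (\<Sum>i\<in>F. \<bar>y i\<bar>)"
  have ysum: "0 < (\<Sum>i\<in>F. \<bar>y i\<bar>)" using y(2) finF by (metis abs_ge_zero sum_pos2 zero_less_abs_iff)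
  have e: "0 < e" using mu(1) ysum by (simp add: e_def)
  have ey: "\<bar>e * y i\<bar> \<le> mu" if "i \<in> F" for i
  proof -
    have "\<bar>y i\<bar> \<le> (\<Sum>i\<in>F. \<bar>y i\<bar>)" using that finF by (intro member_le_sum) auto
    then have "e * \<bar>y i\<bar> \<le> e * (\<Sum>i\<in>F. \<bar>y i\<bar>)" using e by (intro mult_left_mono) auto
    also have "\<dots> = mu" using ysum by (simp add: e_def)
    finally show ?thesis using e by (simp add: abs_mult)
  qed
  define p where "p s = vec n (\<lambda>i. x $ i + s * (e * y i))" for s :: real
  have p: "p s \<in> polytope A d" if s: "\<bar>s\<bar> = 1" for s
    unfolding polytope_iff[OF d]
  proof (intro conjI allI impI)
    show "dim_vec (p s) = dim_col A" by (simp add: p_def n_def)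
    fix r assume r: "r < dim_row A"
    have "(\<Sum>i<n. real (A $$ (r, i)) * p s $ i)
        = (\<Sum>i<n. real (A $$ (r, i)) * x $ i) + s * e * (\<Sum>i<n. real (A $$ (r, i)) * y i)"
      by (simp add: p_def sum.distrib sum_distrib_left algebra_simps)
    then show "(\<Sum>i<dim_col A. real (A $$ (r, i)) * p s $ i) \<le> d $ r"
      using x(2)[OF r] yn[OF r] by (simp add: n_def)
  next
    fix i assume "i < dim_col A"
    then have i: "i < n" by (simp add: n_def)
    have "\<bar>s * (e * y i)\<bar> \<le> x $ i \<and> \<bar>s * (e * y i)\<bar> \<le> 1 - x $ i"
    proof (cases "i \<in> F")
      case True
      have "\<bar>s * (e * y i)\<bar> = \<bar>e * y i\<bar>" using s by (simp add: abs_mult)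
      then show ?thesis using ey[OF True] mu(2)[OF True] by linarith
    next
      case False
      then show ?thesis using y(1) x(3)[OF i] by simp
    qed
    then show "0 \<le> p s $ i" "p s $ i \<le> 1" using i by (auto simp: p_def)
  qed
  obtain i where i: "i \<in> F" "y i \<noteq> 0" using y(2) by blast
  have "p 1 $ i \<noteq> p (-1) $ i" using i Fn e by (auto simp: p_def)
  then have "p 1 \<noteq> p (-1)" by metis
  moreover have "x = (1 - 1 / 2) \<cdot>\<^sub>v p 1 + (1 / 2) \<cdot>\<^sub>v p (-1)"
    using x(1) by (intro eq_vecI) (auto simp: p_def field_simps)
  moreover have "0 < (1 / 2 :: real)" "1 / 2 < (1 :: real)" by simp_all
  ultimately show False
    using ext p[of 1] p[of "-1"] unfolding extreme_point_def by (metis abs_minus abs_one)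
qed

section \<open>Configurations in numerical form and their test\<close>

lemma configuration_subset:
  assumes "configuration a b N t k" "S \<subseteq> N" "k \<le> card S"
  shows "configuration a b S t k"
proof -
  have fin: "finite N" using assms(1) finite_subset[of N "{..<dim_vec a}"] by (auto simp: configuration_def)
  have "(\<Sum>i\<in>S. a $ i) \<le> (\<Sum>i\<in>N. a $ i)" using assms(2) fin by (intro sum_mono2) auto
  then show ?thesis using assms unfolding configuration_def by auto
qed

text \<open>Removing an element of \<open>Q\<close> from \<open>Q \<union> {t}\<close> leaves a
  subset of size \<open>k - 1\<close> with \<open>t\<close>, and each such subset arises in this way
  because \<open>card S \<ge> k\<close>. Removing \<open>t\<close> leaves a subset of
  \<open>S\<close>, which fits.\<close>

lemma violated_iff:
  "violated (dim_vec a) (($) a) b (($) x) S t k \<longleftrightarrow>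
    configuration a b S t k \<and> \<not> configuration_ineq S t k x"
proof -
  let ?n = "dim_vec a"
  have ineq: "\<not> configuration_ineq S t k x \<longleftrightarrow>
      (real k - 1) * x $ t < (\<Sum>i\<in>S. x $ i + x $ t - 1)"
    by (auto simp: configuration_ineq_def sum_subtractf sum.distrib algebra_simps)
  have config: "configuration a b S t k \<longleftrightarrow> S \<subseteq> {..<?n} \<and> t < ?n \<and> t \<notin> S \<and> 2 \<le> k \<and> k \<le> card S \<and>
     sum (($) a) S \<le> b \<and> (\<forall>Q\<subseteq>S. card Q = k \<longrightarrow> b < sum (($) a) Q + a $ t) \<and>
     (\<forall>Q\<subseteq>S. card Q = k - 1 \<longrightarrow> sum (($) a) Q + a $ t \<le> b)" (is "?L \<longleftrightarrow> ?R")
  proof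
    assume ?L
    then have L: "S \<subset> {..<?n}" "t < ?n" "t \<notin> S" "2 \<le> k" "k \<le> card S" "sum (($) a) S \<le> b"
      "\<And>Q. Q \<subseteq> S \<Longrightarrow> card Q = k \<Longrightarrow> minimal_cover a b (Q \<union> {t})"
      by (auto simp: configuration_def)
    have finS: "finite S" using L(1) finite_subset by blast
    have sum_insert: "sum (($) a) (Q \<union> {t}) = sum (($) a) Q + a $ t" if "Q \<subseteq> S" for Q
    proof -
      have "finite Q" "t \<notin> Q" using that finS L(3) finite_subset by auto
      then show ?thesis by simp
    qed
    have "b < sum (($) a) Q + a $ t" if "Q \<subseteq> S" "card Q = k" for Q
      using L(7)[OF that] sum_insert[OF that(1)] by (simp add: minimal_cover_def cover_def)
    moreover have "sum (($) a) Q + a $ t \<le> b" if Q: "Q \<subseteq> S" "card Q = k - 1" for Q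
    proof -
      have finQ: "finite Q" using Q finS finite_subset by blast
      have "Q \<noteq> S" using Q L(4,5) by auto
      then obtain j where j: "j \<in> S" "j \<notin> Q" using Q by blast
      have "minimal_cover a b (insert j Q \<union> {t})" using L(4,7) Q j finQ by auto
      then have "sum (($) a) (insert j Q \<union> {t} - {j}) \<le> b" unfolding minimal_cover_def by blast
      moreover have "insert j Q \<union> {t} - {j} = Q \<union> {t}" using j L(3) by auto
      ultimately show ?thesis using sum_insert[OF Q(1)] by metis
    qed
    ultimately show ?R using L by blast
  next
    assume R: ?R
    then have finS: "finite S" using finite_subset by blast
    have "minimal_cover a b (Q \<union> {t})" if Q: "Q \<subseteq> S" "card Q = k" for Q
      unfolding minimal_cover_def cover_def
    proof (intro conjI ballI)
      have finQ: "finite Q" and tQ: "t \<notin> Q" using finite_subset Q finS R by auto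
      show "Q \<union> {t} \<subseteq> {..<?n}" using Q R by auto
      have "b < sum (($) a) Q + a $ t" using Q R by blast
      then show "b < sum (($) a) (Q \<union> {t})" using finQ tQ by (simp add: add.commute)
      fix j assume j: "j \<in> Q \<union> {t}"
      show "sum (($) a) (Q \<union> {t} - {j}) \<le> b"
      proof (cases "j = t")
        case True
        have "sum (($) a) Q \<le> sum (($) a) S" using Q finS by (intro sum_mono2) auto
        moreover have "Q \<union> {t} - {j} = Q" using True tQ by auto
        ultimately show ?thesis using R by simp
      next
        case False
        then have "Q \<union> {t} - {j} = insert t (Q - {j})" by auto
        moreover have "Q - {j} \<subseteq> S" "card (Q - {j}) = k - 1" using False j Q finQ by auto
        then have "sum (($) a) (Q - {j}) + a $ t \<le> b" using R by blast
        ultimately show ?thesis using finQ tQ by simp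
      qed
    qed
    moreover have "S \<subset> {..<?n}" using R by auto
    ultimately show ?L using R unfolding configuration_def by auto
  qed
  show ?thesis unfolding violated_def config ineq by blast
qed

text \<open>Membership among the \<open>c\<close> smallest is decided by counting predecessors:
  unlike sorting, this is directly a nested bounded sum.\<close>

definition smallest_sum :: "nat \<Rightarrow> (nat \<Rightarrow> nat) \<Rightarrow> nat set \<Rightarrow> nat \<Rightarrow> nat" where
  "smallest_sum n a S c =
     (\<Sum>i\<in>S. of_bool (card {j \<in> S. key n a j < key n a i} < c) * a i)"

text \<open>Keys are distinct, so the ranks are exactly the numbers below \<open>card S\<close> and
  the selected set \<open>L\<close> has \<open>c\<close> elements. Minimality is an exchange
  argument: \<open>L - Q\<close> and \<open>Q - L\<close> have equal size, and each element of the
  former weighs at most as much as each of the latter.\<close>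

lemma smallest_sum:
  assumes S: "S \<subseteq> {..<n}" and c: "c \<le> card S"
  shows "\<exists>L\<subseteq>S. card L = c \<and> sum a L = smallest_sum n a S c"
    and "\<And>Q. Q \<subseteq> S \<Longrightarrow> card Q = c \<Longrightarrow> smallest_sum n a S c \<le> sum a Q"
proof -
  define rank where "rank i = card {j \<in> S. key n a j < key n a i}" for i
  have finS: "finite S" using S finite_subset by blast
  have mono: "rank i < rank j" if "i \<in> S" "key n a i < key n a j" for i j
    unfolding rank_def using that finS by (intro psubset_card_mono) auto
  have "inj_on rank S"
  proof (rule inj_onI)
    fix i j assume ij: "i \<in> S" "j \<in> S" "rank i = rank j"
    then have "key n a i = key n a j" using mono[of i j] mono[of j i] by (metis less_irrefl linorder_neqE)
    then show "i = j" using ij S by (intro key_inj[of n a i j]) auto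
  qed
  have "rank i < card S" if "i \<in> S" for i
    unfolding rank_def using that finS by (intro psubset_card_mono) auto
  then have img: "rank ` S = {..<card S}"
    using card_image[OF \<open>inj_on rank S\<close>] by (intro card_subset_eq) auto
  define L where "L = {i \<in> S. rank i < c}"
  have finL: "finite L" using finS by (simp add: L_def)
  have "rank ` L = {..<c}"
  proof
    show "{..<c} \<subseteq> rank ` L"
    proof
      fix q assume q: "q \<in> {..<c}"
      then have "q \<in> rank ` S" using img c by auto
      then show "q \<in> rank ` L" using q by (auto simp: L_def)
    qed
  qed (auto simp: L_def)
  then have cardL: "card L = c"
    using card_image[of rank L] \<open>inj_on rank S\<close> inj_on_subset[of rank S L] by (auto simp: L_def)
  have sumL: "sum a L = smallest_sum n a S c"
    unfolding smallest_sum_def rank_def[symmetric] L_def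
    using finS by (intro sum.mono_neutral_cong_left) auto
  show "\<exists>L\<subseteq>S. card L = c \<and> sum a L = smallest_sum n a S c"
    using cardL sumL by (intro exI[of _ L]) (auto simp: L_def)
  fix Q assume Q: "Q \<subseteq> S" "card Q = c"
  have finQ: "finite Q" using Q finS finite_subset by blast
  have card_eq: "card (L - Q) = card (Q - L)"
    using card_Diff_subset_Int[of L Q] card_Diff_subset_Int[of Q L] finL finQ cardL Q(2)
    by (simp add: Int_commute)
  have le: "a l \<le> a q" if "l \<in> L - Q" "q \<in> Q - L" for l q
  proof -
    have "rank l < rank q" using that Q by (auto simp: L_def)
    then have "key n a l \<le> key n a q" using mono[of q l] that Q by force
    then show ?thesis using key_le_imp_le[of n a l q] that Q S by auto
  qed
  have "sum a (L - Q) \<le> sum a (Q - L)"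
  proof (cases "Q - L = {}")
    case True
    then have "card (L - Q) = 0" using card_eq by (metis card.empty)
    then have "L - Q = {}" using finL by (metis card_0_eq finite_Diff)
    then show ?thesis by (metis sum.empty zero_le)
  next
    case False
    then obtain q where q: "q \<in> Q - L" "\<And>i. i \<in> Q - L \<Longrightarrow> a q \<le> a i"
      using obtain_min[of "Q - L" a] finQ by (metis finite_Diff)
    have "sum a (L - Q) \<le> card (L - Q) * a q"
      using sum_bounded_above[of "L - Q" a "a q"] le q(1) by auto
    also have "\<dots> \<le> sum a (Q - L)"
      unfolding card_eq using sum_bounded_below[of "Q - L" "a q" a] q(2) by auto
    finally show ?thesis .
  qed
  moreover have "sum a L = sum a (L - Q) + sum a (L \<inter> Q)" "sum a Q = sum a (Q - L) + sum a (L \<inter> Q)"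
    using finL finQ sum.Int_Diff[of L a Q] sum.Int_Diff[of Q a L] by (simp_all add: Int_commute)
  ultimately show "smallest_sum n a S c \<le> sum a Q" using sumL by linarith
qed

text \<open>The constraint on the \<open>k - 1\<close> largest elements is expressed through the smallest
  \<open>card S + 1 - k\<close> ones, and the violation is scaled by the product of all denominators.\<close>

definition violation_test :: "nat \<Rightarrow> (nat \<Rightarrow> nat) \<Rightarrow> nat \<Rightarrow> (nat \<Rightarrow> nat) \<Rightarrow> (nat \<Rightarrow> nat) \<Rightarrow>
    nat set \<Rightarrow> nat \<Rightarrow> nat \<Rightarrow> bool" where
  "violation_test n a b num den S t k \<longleftrightarrow> t < n \<and> 2 \<le> k \<and> k \<le> card S \<and> sum a S \<le> b \<and>
     b < smallest_sum n a S k + a t \<and> sum a S + a t \<le> b + smallest_sum n a S (card S + 1 - k) \<and>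
     (let D = \<Prod>i<n. den i in
        D * card S < (card S + 1 - k) * (num t * (D div den t)) + (\<Sum>i\<in>S. num i * (D div den i)))"

lemma violation_test_iff:
  assumes S: "S \<subseteq> {..<n}" "t \<notin> S"
    and x: "\<And>i. i < n \<Longrightarrow> 0 < den i \<and> x i = real (num i) / real (den i)"
  shows "violation_test n a b num den S t k \<longleftrightarrow> violated n a b x S t k"
proof (cases "t < n \<and> 2 \<le> k \<and> k \<le> card S")
  case False
  then show ?thesis by (auto simp: violation_test_def violated_def)
next
  case True
  then have t: "t < n" and k: "2 \<le> k" "k \<le> card S" by auto
  have finS: "finite S" using S finite_subset by blast
  have low: "b < smallest_sum n a S k + a t \<longleftrightarrow> (\<forall>Q\<subseteq>S. card Q = k \<longrightarrow> b < sum a Q + a t)"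
    using smallest_sum[OF S(1) k(2), where a = a] by (metis add_le_cancel_right order_less_le_trans)
  have up: "sum a S + a t \<le> b + smallest_sum n a S (card S + 1 - k) \<longleftrightarrow>
    (\<forall>Q\<subseteq>S. card Q = k - 1 \<longrightarrow> sum a Q + a t \<le> b)" (is "?L \<longleftrightarrow> ?R")
  proof -
    have c: "card S + 1 - k \<le> card S" using k by simp
    note sm = smallest_sum[OF S(1) c, where a = a]
    have split: "sum a S = sum a Q + sum a (S - Q)" if "Q \<subseteq> S" for Q
      using that finS by (metis add.commute sum.subset_diff)
    show ?thesis
    proof
      assume L: ?L
      show ?R
      proof (intro allI impI)
        fix Q assume Q: "Q \<subseteq> S" "card Q = k - 1"
        have "card (S - Q) = card S + 1 - k"
          using Q finS k finite_subset[OF Q(1) finS] by (simp add: card_Diff_subset)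
        then have "smallest_sum n a S (card S + 1 - k) \<le> sum a (S - Q)" by (intro sm(2)) auto
        then show "sum a Q + a t \<le> b" using L split[OF Q(1)] by linarith
      qed
    next
      assume R: ?R
      from sm(1) obtain L where L: "L \<subseteq> S" "card L = card S + 1 - k"
        "sum a L = smallest_sum n a S (card S + 1 - k)" by blast
      have "card (S - L) = k - 1"
        using L finS k finite_subset[OF L(1) finS] by (simp add: card_Diff_subset)
      then have "sum a (S - L) + a t \<le> b" using R by blast
      then show ?L using split[OF L(1)] L(3) by linarith
    qed
  qed
  define D where "D = (\<Prod>i<n. den i)"
  have D: "0 < D" unfolding D_def using x by (intro prod_pos) auto
  have scale: "real (num i * (D div den i)) = D * x i" if "i < n" for i
  proof -
    \<comment> \<open>So \<open>D div den i\<close> is exact, and the integer test is the real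
      inequality multiplied by \<open>D\<close>.\<close>
    have "den i dvd D" unfolding D_def using that by (intro dvd_prodI) auto
    then have "real (D div den i) = real D / real (den i)" by (rule real_of_nat_div)
    then show ?thesis using x[OF that] by simp
  qed
  have "D * card S < (card S + 1 - k) * (num t * (D div den t)) + (\<Sum>i\<in>S. num i * (D div den i)) \<longleftrightarrow>
      real (D * card S) < real ((card S + 1 - k) * (num t * (D div den t)) + (\<Sum>i\<in>S. num i * (D div den i)))"
    by (simp only: of_nat_less_iff)
  also have "real ((card S + 1 - k) * (num t * (D div den t)) + (\<Sum>i\<in>S. num i * (D div den i)))
      = real (card S + 1 - k) * (D * x t) + (\<Sum>i\<in>S. D * x i)"
  proof -
    have "real (\<Sum>i\<in>S. num i * (D div den i)) = (\<Sum>i\<in>S. D * x i)"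
      unfolding of_nat_sum using S(1) by (intro sum.cong refl scale) auto
    then show ?thesis unfolding of_nat_add of_nat_mult[of "card S + 1 - k"] scale[OF t] by simp
  qed
  also have "\<dots> = real D * ((real (card S) + 1 - real k) * x t + (\<Sum>i\<in>S. x i))"
    using k by (simp add: of_nat_diff sum_distrib_left algebra_simps)
  also have "real (D * card S) < \<dots> \<longleftrightarrow>
      real (card S) < (real (card S) + 1 - real k) * x t + (\<Sum>i\<in>S. x i)"
    using D by simp
  also have "\<dots> \<longleftrightarrow> (real k - 1) * x t < (\<Sum>i\<in>S. x i + x t - 1)"
    by (auto simp: sum_subtractf sum.distrib algebra_simps)
  finally show ?thesis
    unfolding violation_test_def violated_def Let_def D_def[symmetric] low up
    using S t by blast
qed

subsection \<open>Layout of the input word\<close>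

lemma concat_uniform:
  assumes "\<And>r. r < m \<Longrightarrow> length (f r) = n"
  shows "length (concat (map f [0..<m])) = m * n"
    and "r < m \<Longrightarrow> i < n \<Longrightarrow> concat (map f [0..<m]) ! (r * n + i) = f r ! i"
proof -
  show len: "length (concat (map f [0..<m])) = m * n"
    using assms by (induction m) auto
  show "concat (map f [0..<m]) ! (r * n + i) = f r ! i" if "r < m" "i < n"
    using that assms
  proof (induction m)
    case (Suc m)
    have len: "length (concat (map f [0..<m])) = m * n"
      using Suc.prems(3) by (induction m) auto
    show ?case
    proof (cases "r = m")
      case True
      then show ?thesis using len by (simp add: nth_append)
    next
      case False
      then have r: "r < m" using Suc.prems(1) by simp
      have "Suc r * n \<le> m * n" using r by (intro mult_right_mono) auto
      then have "r * n + i < m * n" using Suc.prems(2) by simp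
      then show ?thesis using Suc r len by (simp add: nth_append)
    qed
  qed simp
qed

lemma load_Suc: "p < length ws \<Longrightarrow> load ws ''in'' (Suc p) = ws ! p"
  by (simp add: load_def)

text \<open>Cell 0 of the input array holds the length of the word, so everything is shifted by one:
  the row count is in cell 1, the column count in cell 2, and the matrix starts at cell 3.
  Numerators and denominators alternate at the end.\<close>

definition dim_in :: "(nat \<Rightarrow> nat) \<Rightarrow> nat" where
  "dim_in inp = inp 2"

definition weight_in :: "(nat \<Rightarrow> nat) \<Rightarrow> nat \<Rightarrow> nat \<Rightarrow> nat" where
  "weight_in inp r i = inp (3 + (r * dim_in inp + i))"

definition capacity_in :: "nat \<Rightarrow> (nat \<Rightarrow> nat) \<Rightarrow> nat \<Rightarrow> nat" where
  "capacity_in m inp r = inp (3 + (m * dim_in inp + r))"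

definition num_in :: "nat \<Rightarrow> (nat \<Rightarrow> nat) \<Rightarrow> nat \<Rightarrow> nat" where
  "num_in m inp i = inp (3 + (m * dim_in inp + (m + (dim_in inp + 2 * i))))"

definition den_in :: "nat \<Rightarrow> (nat \<Rightarrow> nat) \<Rightarrow> nat \<Rightarrow> nat" where
  "den_in m inp i = inp (4 + (m * dim_in inp + (m + (dim_in inp + 2 * i))))"

lemma load_enc_input:
  fixes I :: config_sp
  defines "inp \<equiv> load (enc_input I) ''in''" and "m \<equiv> dim_row (mat_A I)" and "n \<equiv> dim_col (mat_A I)"
  assumes d: "dim_vec (rhs_d I) = m" and c: "dim_vec (obj_c I) = n" and x: "dim_vec (opt_x I) = n"
  shows "length (enc_input I) = 2 + m * n + m + n + 2 * n"
    and "dim_in inp = n"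
    and "\<And>r i. r < m \<Longrightarrow> i < n \<Longrightarrow> weight_in inp r i = mat_A I $$ (r, i)"
    and "\<And>r. r < m \<Longrightarrow> capacity_in m inp r = rhs_d I $ r"
    and "\<And>i. i < n \<Longrightarrow> num_in m inp i = nat (fst (quotient_of (opt_x I $ i)))"
    and "\<And>i. i < n \<Longrightarrow> den_in m inp i = nat (snd (quotient_of (opt_x I $ i)))"
proof -
  define f where "f r = list_of_vec (row (mat_A I) r)" for r
  define g where "g i = enc_rat (opt_x I $ i)" for i
  define As where "As = concat (map f [0..<m])"
  define xs where "xs = concat (map g [0..<n])"
  have lens: "length As = m * n" "length xs = n * 2"
    unfolding As_def xs_def by (rule concat_uniform; simp add: f_def g_def enc_rat_def n_def)+
  have "map enc_rat (list_of_vec (opt_x I)) = map g [0..<n]"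
    using x by (intro nth_equalityI) (simp_all add: g_def list_of_vec_index)
  then have enc: "enc_input I = [m, n] @ As @ list_of_vec (rhs_d I) @ list_of_vec (obj_c I) @ xs"
    by (simp add: enc_input_def As_def f_def[abs_def] xs_def m_def n_def)
  show len: "length (enc_input I) = 2 + m * n + m + n + 2 * n"
    using d c lens by (simp add: enc)
  have at: "inp (Suc p) = enc_input I ! p" if "p < length (enc_input I)" for p
    unfolding inp_def using that by (rule load_Suc)
  have at3: "inp (3 + q) = enc_input I ! (2 + q)" if "2 + q < length (enc_input I)" for q
    using at[OF that] by (simp add: eval_nat_numeral)
  show dim: "dim_in inp = n"
    using at[of 1] len by (simp add: dim_in_def enc numeral_2_eq_2)
  show "weight_in inp r i = mat_A I $$ (r, i)" if "r < m" "i < n" for r i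
  proof -
    have "Suc r * n \<le> m * n" using that by (intro mult_right_mono) auto
    then have p: "r * n + i < m * n" using that by simp
    have "weight_in inp r i = enc_input I ! (2 + (r * n + i))"
      unfolding weight_in_def dim using at3[of "r * n + i"] len p by simp
    also have "\<dots> = As ! (r * n + i)"
      using lens p by (simp add: enc nth_append)
    also have "\<dots> = f r ! i"
      unfolding As_def using that by (intro concat_uniform) (simp_all add: f_def n_def)
    finally show ?thesis using that by (simp add: f_def list_of_vec_index m_def n_def)
  qed
  show "capacity_in m inp r = rhs_d I $ r" if "r < m" for r
  proof -
    have "capacity_in m inp r = enc_input I ! (2 + (m * n + r))"
      unfolding capacity_in_def dim using at3[of "m * n + r"] len that by simp
    also have "\<dots> = rhs_d I $ r"
      using lens that d by (simp add: enc nth_append list_of_vec_index)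
    finally show ?thesis .
  qed
  have xs_at: "enc_input I ! (2 + (m * n + (m + (n + q)))) = xs ! q" for q
    using lens d c by (simp add: enc nth_append)
  have xs_nth: "xs ! (i * 2 + j) = g i ! j" if "i < n" "j < 2" for i j
    unfolding xs_def using that by (intro concat_uniform) (simp_all add: g_def enc_rat_def)
  show "num_in m inp i = nat (fst (quotient_of (opt_x I $ i)))" if "i < n" for i
  proof -
    have "num_in m inp i = enc_input I ! (2 + (m * n + (m + (n + 2 * i))))"
      unfolding num_in_def dim using at3[of "m * n + (m + (n + 2 * i))"] len that by simp
    then show ?thesis using xs_at[of "2 * i"] xs_nth[of i 0] that
      by (simp add: g_def enc_rat_def mult.commute)
  qed
  show "den_in m inp i = nat (snd (quotient_of (opt_x I $ i)))" if "i < n" for i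
  proof -
    have "den_in m inp i = enc_input I ! (2 + (m * n + (m + (n + (2 * i + 1)))))"
      unfolding den_in_def dim using at3[of "m * n + (m + (n + (2 * i + 1)))"] len that
      by (simp add: eval_nat_numeral)
    then show ?thesis using xs_at[of "2 * i + 1"] xs_nth[of i 1] that
      by (simp add: g_def enc_rat_def mult.commute)
  qed
qed

subsection \<open>The search as an expression\<close>

lemma fold_add: "fold (\<lambda>i acc. acc + f i) [0..<n] (c::nat) = c + (\<Sum>i<n. f i)"
  by (induction n) auto

lemma fold_mult: "fold (\<lambda>i acc. acc * f i) [0..<n] (c::nat) = c * (\<Prod>i<n. f i)"
  by (induction n) auto

lemma prod_of_bool: "(\<Prod>i<(n::nat). of_bool (P i) :: nat) = of_bool (\<forall>i<n. P i)"
  by (induction n) (auto simp: less_Suc_eq)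

lemma of_bool_mult: "(of_bool P * of_bool Q :: nat) = of_bool (P \<and> Q)"
  by simp

lemma one_minus_of_bool: "(1 - of_bool P :: nat) = of_bool (\<not> P)"
  by simp

text \<open>Tuples of a fixed length become single numbers, so one loop of \<open>inp 0 ^ k\<close>
  rounds enumerates them all.\<close>

definition digit :: "nat \<Rightarrow> nat \<Rightarrow> nat \<Rightarrow> nat" where
  "digit l G i = G div l ^ i mod l"

lemma digits_exist:
  assumes "\<forall>q\<in>set ds. q < l"
  shows "\<exists>G<l ^ length ds. \<forall>i<length ds. digit l G i = ds ! i"
  using assms
proof (induction ds)
  case (Cons q ds)
  then obtain G where G: "G < l ^ length ds" "\<forall>i<length ds. digit l G i = ds ! i" by auto
  have q: "q < l" using Cons.prems by simp
  have "Suc G * l \<le> l ^ length ds * l" using G(1) by (intro mult_right_mono) auto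
  then have "q + l * G < l ^ length (q # ds)" using q by (simp add: algebra_simps)
  moreover have "digit l (q + l * G) i = (q # ds) ! i" if "i < length (q # ds)" for i
  proof (cases i)
    case 0
    then show ?thesis using q by (simp add: digit_def)
  next
    case (Suc j)
    have "(q + l * G) div l ^ i = G div l ^ j" using q by (simp add: Suc div_mult2_eq)
    then show ?thesis using G(2) that Suc by (simp add: digit_def)
  qed
  ultimately show ?case by blast
qed simp

text \<open>A guess \<open>G\<close> encodes, in base \<open>inp 0\<close>, the numbers \<open>r\<close>, \<open>t\<close>, \<open>k\<close>, \<open>u\<close>, \<open>z\<close> followed by
  lists of length \<open>m + 1\<close> and \<open>2 * m\<close> for the sets \<open>P\<close> and \<open>R\<close>; entries \<open>\<ge> dim_in inp\<close> are padding.\<close>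

definition guess_set :: "nat \<Rightarrow> (nat \<Rightarrow> nat) \<Rightarrow> nat \<Rightarrow> nat set" where
  "guess_set m inp G = (let n = dim_in inp; dg = digit (inp 0) G; a = weight_in inp (dg 0) in
     {i. i < n \<and> i \<noteq> dg 1 \<and> i \<notin> dg ` {6 + m..<6 + 3 * m} \<and>
       (i \<in> dg ` {5..<6 + m} \<or> num_in m inp i = den_in m inp i \<and>
         key n a (dg 3) \<le> key n a i \<and> key n a i \<le> key n a (dg 4))})"

text \<open>The resulting set is tested outright, so digits out of range for \<open>u\<close>,
  \<open>z\<close> or the two lists cannot make an accepted guess wrong.\<close>

definition good_guess :: "nat \<Rightarrow> (nat \<Rightarrow> nat) \<Rightarrow> nat \<Rightarrow> bool" where
  "good_guess m inp G \<longleftrightarrow> (let dg = digit (inp 0) G in dg 0 < m \<and>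
     violation_test (dim_in inp) (weight_in inp (dg 0)) (capacity_in m inp (dg 0))
       (num_in m inp) (den_in m inp) (guess_set m inp G) (dg 1) (dg 2))"

text \<open>Truth values are 0 and 1. Since subtraction is truncated, \<open>1 - (e - f)\<close> is
  an indicator; conjunction is then the product.\<close>

definition E_le :: "expr \<Rightarrow> expr \<Rightarrow> expr" where
  "E_le e f = Bin Sub (Cst 1) (Bin Sub e f)"

lemma eval_E_le [simp]: "eval (E_le e f) inp env = of_bool (eval e inp env \<le> eval f inp env)"
  by (auto simp: E_le_def)

definition E_less :: "expr \<Rightarrow> expr \<Rightarrow> expr" where
  "E_less e f = E_le (Bin Add e (Cst 1)) f"

lemma eval_E_less [simp]: "eval (E_less e f) inp env = of_bool (eval e inp env < eval f inp env)"
  by (auto simp: E_less_def)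

definition E_eq :: "expr \<Rightarrow> expr \<Rightarrow> expr" where
  "E_eq e f = Bin Mul (E_le e f) (E_le f e)"

lemma eval_E_eq [simp]: "eval (E_eq e f) inp env = of_bool (eval e inp env = eval f inp env)"
  by (auto simp: E_eq_def)

definition E_not :: "expr \<Rightarrow> expr" where
  "E_not e = Bin Sub (Cst 1) e"

lemma eval_E_not [simp]: "eval (E_not e) inp env = 1 - eval e inp env"
  by (simp add: E_not_def)

definition E_or :: "expr \<Rightarrow> expr \<Rightarrow> expr" where
  "E_or e f = E_not (Bin Mul (E_not e) (E_not f))"

lemma eval_E_or [simp]:
  "eval (E_or e f) inp env = 1 - (1 - eval e inp env) * (1 - eval f inp env)"
  by (simp add: E_or_def)

primrec E_member :: "expr list \<Rightarrow> expr \<Rightarrow> expr" where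
  "E_member [] e = Cst 0"
| "E_member (f # fs) e = E_or (E_eq f e) (E_member fs e)"

lemma eval_E_member [simp]:
  "eval (E_member fs e) inp env = of_bool (eval e inp env \<in> (\<lambda>f. eval f inp env) ` set fs)"
  by (induction fs) auto

primrec E_power :: "nat \<Rightarrow> expr" where
  "E_power 0 = Cst 1"
| "E_power (Suc k) = Bin Mul (Inp (Cst 0)) (E_power k)"

lemma eval_E_power [simp]: "eval (E_power k) inp env = inp 0 ^ k"
  by (induction k) auto

definition E_digit :: "nat \<Rightarrow> nat \<Rightarrow> expr" where
  "E_digit g i = (let q = Bin Div (Var g) (E_power i) in
     Bin Sub q (Bin Mul (Bin Div q (Inp (Cst 0))) (Inp (Cst 0))))"

lemma eval_E_digit [simp]: "eval (E_digit g i) inp env = digit (inp 0) (env g) i"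
  by (simp add: E_digit_def Let_def digit_def minus_div_mult_eq_mod)

definition E_dim :: expr where
  "E_dim = Inp (Cst 2)"

lemma eval_E_dim [simp]: "eval E_dim inp env = dim_in inp"
  by (simp add: E_dim_def dim_in_def)

definition E_weight :: "nat \<Rightarrow> expr \<Rightarrow> expr" where
  "E_weight g e = Inp (Bin Add (Cst 3) (Bin Add (Bin Mul (E_digit g 0) E_dim) e))"

lemma eval_E_weight [simp]:
  "eval (E_weight g e) inp env = weight_in inp (digit (inp 0) (env g) 0) (eval e inp env)"
  by (simp add: E_weight_def weight_in_def)

definition E_capacity :: "nat \<Rightarrow> nat \<Rightarrow> expr" where
  "E_capacity m g = Inp (Bin Add (Cst 3) (Bin Add (Bin Mul (Cst m) E_dim) (E_digit g 0)))"

lemma eval_E_capacity [simp]: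
  "eval (E_capacity m g) inp env = capacity_in m inp (digit (inp 0) (env g) 0)"
  by (simp add: E_capacity_def capacity_in_def)

definition E_num :: "nat \<Rightarrow> expr \<Rightarrow> expr" where
  "E_num m e = Inp (Bin Add (Cst 3) (Bin Add (Bin Mul (Cst m) E_dim) (Bin Add (Cst m)
     (Bin Add E_dim (Bin Mul (Cst 2) e)))))"

lemma eval_E_num [simp]: "eval (E_num m e) inp env = num_in m inp (eval e inp env)"
  by (simp add: E_num_def num_in_def)

definition E_den :: "nat \<Rightarrow> expr \<Rightarrow> expr" where
  "E_den m e = Inp (Bin Add (Cst 4) (Bin Add (Bin Mul (Cst m) E_dim) (Bin Add (Cst m)
     (Bin Add E_dim (Bin Mul (Cst 2) e)))))"

lemma eval_E_den [simp]: "eval (E_den m e) inp env = den_in m inp (eval e inp env)"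
  by (simp add: E_den_def den_in_def)

definition E_key :: "nat \<Rightarrow> expr \<Rightarrow> expr" where
  "E_key g e = Bin Add (Bin Mul (E_weight g e) E_dim) e"

lemma eval_E_key [simp]: "eval (E_key g e) inp env =
    key (dim_in inp) (weight_in inp (digit (inp 0) (env g) 0)) (eval e inp env)"
  by (simp add: E_key_def key_def)

definition E_sel :: "nat \<Rightarrow> nat \<Rightarrow> expr \<Rightarrow> expr" where
  "E_sel m g e = Bin Mul (E_less e E_dim) (Bin Mul (E_not (E_eq e (E_digit g 1)))
     (Bin Mul (E_not (E_member (map (E_digit g) [6 + m..<6 + 3 * m]) e))
       (E_or (E_member (map (E_digit g) [5..<6 + m]) e)
         (Bin Mul (E_eq (E_num m e) (E_den m e))
           (Bin Mul (E_le (E_key g (E_digit g 3)) (E_key g e))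
             (E_le (E_key g e) (E_key g (E_digit g 4))))))))"

lemma eval_E_sel [simp]:
  "eval (E_sel m g e) inp env = of_bool (eval e inp env \<in> guess_set m inp (env g))"
proof -
  have "(\<lambda>f. eval f inp env) ` set (map (E_digit g) xs) = digit (inp 0) (env g) ` set xs" for xs
    by (simp add: image_image)
  then show ?thesis
    unfolding E_sel_def eval.simps bop_val.simps eval_E_or eval_E_not eval_E_member eval_E_eq
      eval_E_le eval_E_less one_minus_of_bool of_bool_mult eval_E_digit eval_E_dim eval_E_num
      eval_E_den eval_E_key
    by (simp only: guess_set_def Let_def mem_Collect_eq set_upt de_Morgan_conj de_Morgan_disj not_not)
qed

text \<open>Variables: 0 is the output position, 1 and 2 are guesses, the others run over indices.\<close>

definition E_sum :: "nat \<Rightarrow> nat \<Rightarrow> nat \<Rightarrow> expr \<Rightarrow> expr" where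
  "E_sum m g v e = Big Add 0 v 1 (Bin Mul (E_sel m g (Var v)) e)"

lemma guess_set_subset: "guess_set m inp G \<subseteq> {..<dim_in inp}"
  by (auto simp: guess_set_def Let_def)

lemma finite_guess_set: "finite (guess_set m inp G)"
  by (rule finite_subset[OF guess_set_subset finite_lessThan])

text \<open>The loop runs up to \<open>inp 0\<close>; the selector suppresses indices from
  \<open>dim_in inp\<close> on. It reads the guess from variable \<open>g\<close>, which the loop
  variable must not overwrite.\<close>

lemma eval_E_sum [simp]:
  assumes "v \<noteq> g" "dim_in inp \<le> inp 0"
  shows "eval (E_sum m g v e) inp env = (\<Sum>i\<in>guess_set m inp (env g). eval e inp (env(v := i)))"
proof -
  have "eval (E_sum m g v e) inp env
      = (\<Sum>i<inp 0. of_bool (i \<in> guess_set m inp (env g)) * eval e inp (env(v := i)))"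
    using assms(1) by (simp add: E_sum_def fold_add)
  also have "\<dots> = (\<Sum>i\<in>guess_set m inp (env g). eval e inp (env(v := i)))"
    using guess_set_subset[of m inp "env g"] assms(2)
    by (intro sum.mono_neutral_cong_right) auto
  finally show ?thesis .
qed

definition E_smallest :: "nat \<Rightarrow> nat \<Rightarrow> expr \<Rightarrow> expr" where
  "E_smallest m g c = E_sum m g 3 (Bin Mul
     (E_less (E_sum m g 4 (E_less (E_key g (Var 4)) (E_key g (Var 3)))) c) (E_weight g (Var 3)))"

text \<open>\<open>c\<close> is evaluated inside the loop over variable 3, so its value must not
  depend on that variable.\<close>

lemma eval_E_smallest [simp]:
  assumes "g < 3" "dim_in inp \<le> inp 0" "\<And>i. eval c inp (env(3 := i)) = eval c inp env"
  shows "eval (E_smallest m g c) inp env = smallest_sum (dim_in inp)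
    (weight_in inp (digit (inp 0) (env g) 0)) (guess_set m inp (env g)) (eval c inp env)"
  using assms finite_guess_set
  by (simp add: E_smallest_def smallest_sum_def Int_def conj_commute)

text \<open>Indices past the dimension have to contribute the factor 1, which the second summand
  supplies.\<close>

definition E_prod_den :: "nat \<Rightarrow> expr" where
  "E_prod_den m = Big Mul 1 3 1
     (Bin Add (Bin Mul (E_less (Var 3) E_dim) (E_den m (Var 3))) (E_le E_dim (Var 3)))"

lemma eval_E_prod_den [simp]:
  assumes "dim_in inp \<le> inp 0"
  shows "eval (E_prod_den m) inp env = (\<Prod>i<dim_in inp. den_in m inp i)"
proof -
  have "eval (E_prod_den m) inp env =
      (\<Prod>i<inp 0. of_bool (i < dim_in inp) * den_in m inp i + of_bool (dim_in inp \<le> i))"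
    by (simp add: E_prod_den_def fold_mult)
  also have "\<dots> = (\<Prod>i<dim_in inp. den_in m inp i)"
    using assms by (intro prod.mono_neutral_cong_right) auto
  finally show ?thesis .
qed

definition E_card :: "nat \<Rightarrow> nat \<Rightarrow> expr" where
  "E_card m g = E_sum m g 3 (Cst 1)"

lemma eval_E_card [simp]:
  "g < 3 \<Longrightarrow> dim_in inp \<le> inp 0 \<Longrightarrow> eval (E_card m g) inp env = card (guess_set m inp (env g))"
  by (simp add: E_card_def)

definition E_test :: "nat \<Rightarrow> nat \<Rightarrow> expr" where
  "E_test m g =
    (let t = E_digit g 1; k = E_digit g 2; total = E_sum m g 3 (E_weight g (Var 3));
         j = Bin Sub (Bin Add (E_card m g) (Cst 1)) k; D = E_prod_den m;
         scaled = (\<lambda>e. Bin Mul (E_num m e) (Bin Div D (E_den m e)))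
     in Bin Mul (E_less (E_digit g 0) (Cst m))
       (Bin Mul (E_less t E_dim)
       (Bin Mul (E_le (Cst 2) k)
       (Bin Mul (E_le k (E_card m g))
       (Bin Mul (E_le total (E_capacity m g))
       (Bin Mul (E_less (E_capacity m g) (Bin Add (E_smallest m g k) (E_weight g t)))
       (Bin Mul (E_le (Bin Add total (E_weight g t)) (Bin Add (E_capacity m g) (E_smallest m g j)))
         (E_less (Bin Mul D (E_card m g))
           (Bin Add (Bin Mul j (scaled t)) (E_sum m g 3 (scaled (Var 3))))))))))))"

lemma eval_E_test [simp]:
  assumes "g < 3" "dim_in inp \<le> inp 0"
  shows "eval (E_test m g) inp env = of_bool (good_guess m inp (env g))"
proof -
  have "3 \<noteq> g" using assms(1) by simp
  then show ?thesis
    using assms unfolding E_test_def good_guess_def violation_test_def Let_def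
    by (simp del: of_bool_conj mult_eq_0_iff add: of_bool_conj[symmetric] of_bool_mult)
qed

section \<open>Selecting the least good guess and printing it\<close>

definition guess_length :: "nat \<Rightarrow> nat" where
  "guess_length m = 6 + 3 * m"

text \<open>At most one guess is least, so multiplying by this indicator and summing over all
  guesses in \<open>E_pick\<close> returns the value at that guess. It replaces the assignment and
  early exit that expressions do not have.\<close>

definition E_least :: "nat \<Rightarrow> expr" where
  "E_least m = Bin Mul (E_test m 1) (Big Mul 1 2 (guess_length m)
     (E_not (Bin Mul (E_less (Var 2) (Var 1)) (E_test m 2))))"

lemma eval_E_least [simp]:
  assumes "dim_in inp \<le> inp 0"
  shows "eval (E_least m) inp env = of_bool (good_guess m inp (env 1) \<and>
    (\<forall>G<inp 0 ^ guess_length m. \<not> (G < env 1 \<and> good_guess m inp G)))"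
  using assms unfolding E_least_def
  by (simp only: eval.simps bop_val.simps eval_E_test eval_E_not eval_E_less fold_mult
      of_bool_mult one_minus_of_bool prod_of_bool fun_upd_same fun_upd_other) simp

definition E_pick :: "nat \<Rightarrow> expr \<Rightarrow> expr" where
  "E_pick m e = Big Add 0 1 (guess_length m) (Bin Mul (E_least m) e)"

lemma eval_E_pick_none:
  assumes "dim_in inp \<le> inp 0" "\<And>G. G < inp 0 ^ guess_length m \<Longrightarrow> \<not> good_guess m inp G"
  shows "eval (E_pick m e) inp env = 0"
  using assms by (simp add: E_pick_def fold_add)

lemma eval_E_pick_some:
  assumes dim: "dim_in inp \<le> inp 0" and G: "G < inp 0 ^ guess_length m" "good_guess m inp G"
    and least: "\<And>G'. G' < G \<Longrightarrow> \<not> good_guess m inp G'"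
  shows "eval (E_pick m e) inp env = eval e inp (env(1 := G))"
proof -
  let ?K = "inp 0 ^ guess_length m"
  have "eval (E_pick m e) inp env = (\<Sum>H<?K. of_bool (good_guess m inp H \<and>
      (\<forall>G<?K. \<not> (G < H \<and> good_guess m inp G))) * eval e inp (env(1 := H)))"
    unfolding E_pick_def eval.simps bop_val.simps fold_add eval_E_least[OF dim] fun_upd_same by simp
  also have "\<dots> = (\<Sum>H<?K. if H = G then eval e inp (env(1 := H)) else 0)"
  proof (intro sum.cong refl)
    fix H assume H: "H \<in> {..<?K}"
    have "good_guess m inp H \<and> (\<forall>G<?K. \<not> (G < H \<and> good_guess m inp G)) \<longleftrightarrow> H = G"
      using G least H by (metis lessThan_iff linorder_neqE_nat)
    then show "of_bool (good_guess m inp H \<and> (\<forall>G<?K. \<not> (G < H \<and> good_guess m inp G)))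
        * eval e inp (env(1 := H)) = (if H = G then eval e inp (env(1 := H)) else 0)" by simp
  qed
  also have "\<dots> = eval e inp (env(1 := G))" using G(1) by simp
  finally show ?thesis .
qed

text \<open>A failed search makes \<open>E_pick\<close> 0, which gives length 1 and, in
  \<open>E_answer\<close>, the entry 0: the report \<open>[0]\<close>.\<close>

definition E_answer_length :: "nat \<Rightarrow> expr" where
  "E_answer_length m = Bin Add (Cst 1) (E_pick m (Bin Add (Cst 3) (Bin Mul (Cst 2) E_dim)))"

definition E_answer :: "nat \<Rightarrow> expr" where
  "E_answer m = (let j = Var 0; pos = (\<lambda>p e. Bin Mul (E_eq j (Cst p)) e) in
     E_pick m (Bin Add (pos 0 (Cst 1)) (Bin Add (pos 1 (E_digit 1 0)) (Bin Add (pos 2 (E_digit 1 1))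
       (Bin Add (pos 3 (E_digit 1 2))
         (Bin Add (Bin Mul (E_le (Cst 4) j) (E_sel m 1 (Bin Sub j (Cst 4))))
           (Bin Mul (E_le (Bin Add (Cst 4) E_dim) j)
             (E_sel m 1 (Bin Sub j (Bin Add (Cst 4) E_dim))))))))))"

definition answer_word :: "nat \<Rightarrow> (nat \<Rightarrow> nat) \<Rightarrow> nat \<Rightarrow> nat list" where
  "answer_word m inp G = (let dg = digit (inp 0) G; S = guess_set m inp G in
     [1, dg 0, dg 1, dg 2] @ enc_set (dim_in inp) S @ enc_set (dim_in inp) S)"

lemma answer_none:
  assumes "dim_in inp \<le> inp 0" "\<And>G. G < inp 0 ^ guess_length m \<Longrightarrow> \<not> good_guess m inp G"
  shows "eval (E_answer_length m) inp env = 1" "eval (E_answer m) inp env = 0"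
  using eval_E_pick_none[OF assms] by (simp_all add: E_answer_length_def E_answer_def Let_def)

lemma answer_some:
  assumes "dim_in inp \<le> inp 0" "G < inp 0 ^ guess_length m" "good_guess m inp G"
    "\<And>G'. G' < G \<Longrightarrow> \<not> good_guess m inp G'"
  shows "eval (E_answer_length m) inp env = 4 + 2 * dim_in inp"
    and "map (\<lambda>j. eval (E_answer m) inp (env(0 := j))) [0..<4 + 2 * dim_in inp]
      = answer_word m inp G"
proof -
  have pick: "eval (E_pick m e) inp env' = eval e inp (env'(1 := G))" for e env'
    using assms by (rule eval_E_pick_some)
  show "eval (E_answer_length m) inp env = 4 + 2 * dim_in inp"
    using pick by (simp add: E_answer_length_def)
  let ?n = "dim_in inp" and ?S = "guess_set m inp G" and ?dg = "digit (inp 0) G"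
  have word: "eval (E_answer m) inp (env(0 := j)) = of_bool (j = 0) + (of_bool (j = 1) * ?dg 0 +
      (of_bool (j = 2) * ?dg 1 + (of_bool (j = 3) * ?dg 2 +
      (of_bool (4 \<le> j) * of_bool (j - 4 \<in> ?S) +
        of_bool (4 + ?n \<le> j) * of_bool (j - (4 + ?n) \<in> ?S)))))" for j
    unfolding E_answer_def Let_def pick by simp
  \<comment> \<open>Past the first block, \<open>j - 4\<close> is no longer an index and its
    selector vanishes, so the first indicator block needs no upper limit on
    \<open>j\<close>.\<close>
  have out: "i \<notin> ?S" if "?n \<le> i" for i using guess_set_subset[of m inp G] that by auto
  show "map (\<lambda>j. eval (E_answer m) inp (env(0 := j))) [0..<4 + 2 * ?n] = answer_word m inp G"
  proof (rule nth_equalityI)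
    show "length (map (\<lambda>j. eval (E_answer m) inp (env(0 := j))) [0..<4 + 2 * ?n])
        = length (answer_word m inp G)"
      by (simp add: answer_word_def Let_def enc_set_def)
    fix j assume "j < length (map (\<lambda>j. eval (E_answer m) inp (env(0 := j))) [0..<4 + 2 * ?n])"
    then have j: "j < 4 + 2 * ?n" by simp
    have "answer_word m inp G ! j = eval (E_answer m) inp (env(0 := j))"
    proof (cases "j < 4")
      case True
      then consider "j = 0" | "j = 1" | "j = 2" | "j = 3" by linarith
      then show ?thesis unfolding word by cases (simp_all add: answer_word_def Let_def)
    next
      case False
      then have nth: "answer_word m inp G ! j = (enc_set ?n ?S @ enc_set ?n ?S) ! (j - 4)"
        unfolding answer_word_def Let_def by (subst nth_append) (simp add: eval_nat_numeral)
      show ?thesis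
      proof (cases "j < 4 + ?n")
        case True
        then have "j - 4 < ?n" using False by linarith
        then show ?thesis using True False unfolding word nth
          by (simp add: nth_append enc_set_def)
      next
        case F: False
        then have "?n \<le> j - 4" "j - 4 - ?n < ?n" using j by linarith+
        then show ?thesis using F False out[of "j - 4"] unfolding word nth
          by (simp add: nth_append enc_set_def diff_diff_eq)
      qed
    qed
    then show "map (\<lambda>j. eval (E_answer m) inp (env(0 := j))) [0..<4 + 2 * ?n] ! j
        = answer_word m inp G ! j" using j by simp
  qed
qed

subsection \<open>Correctness of the search\<close>

lemma nth_image_middle:
  "(\<lambda>i. (xs @ ys @ zs) ! i) ` {length xs..<length xs + length ys} = set ys"
proof -
  have "(\<lambda>i. (xs @ ys @ zs) ! i) ` {length xs..<length xs + length ys}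
      = (\<lambda>i. (xs @ ys @ zs) ! i) ` (\<lambda>i. i + length xs) ` {0..<length ys}"
    by (simp add: add.commute)
  also have "\<dots> = (\<lambda>i. ys ! i) ` {0..<length ys}"
    unfolding image_image by (intro image_cong) (simp_all add: nth_append)
  also have "\<dots> = set ys" using nth_image[of "length ys" ys] by simp
  finally show ?thesis .
qed

text \<open>A set of at most \<open>c\<close> indices is stored in exactly \<open>c\<close> digits;
  the filler \<open>n\<close> is not an index.\<close>

lemma padded_list_exists:
  fixes n :: nat
  assumes "P \<subseteq> {..<n}" "card P \<le> c"
  shows "\<exists>ps. length ps = c \<and> (\<forall>i\<in>set ps. i \<le> n) \<and> (\<forall>i<n. i \<in> set ps \<longleftrightarrow> i \<in> P)"
proof -
  have finP: "finite P" using assms(1) by (rule finite_subset) simp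
  then obtain qs where qs: "set qs = P" "distinct qs" using finite_distinct_list by blast
  then have "length qs \<le> c" using assms(2) distinct_card by metis
  then show ?thesis using qs(1) assms(1)
    by (intro exI[of _ "qs @ replicate (c - length qs) n"]) (auto simp: less_imp_le subset_iff)
qed

lemma violated_cong:
  assumes "\<And>i. i < n \<Longrightarrow> a i = a' i" "\<And>i. i < n \<Longrightarrow> x i = x' i"
    and "violated n a b x S t k"
  shows "violated n a' b x' S t k"
proof -
  have S: "S \<subseteq> {..<n}" and t: "t < n" using assms(3) by (auto simp: violated_def)
  have sums: "sum a' Q = sum a Q" if "Q \<subseteq> S" for Q
    using assms(1) S that by (intro sum.cong) auto
  have "(\<Sum>i\<in>S. x' i + x' t - 1) = (\<Sum>i\<in>S. x i + x t - 1)"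
    using assms(2) S t by (intro sum.cong) auto
  moreover have "a' t = a t" "x' t = x t" using assms(1,2) t by simp_all
  ultimately show ?thesis using assms(3) sums unfolding violated_def by simp
qed

section \<open>Soundness and completeness of the guesses\<close>

locale config_instance =
  fixes I :: config_sp and m :: nat
  assumes input: "config_sp_input I" and rows: "dim_row (mat_A I) = m"
    and extreme: "extreme_point (real_x I) (polytope (mat_A I) (rhs_d I))"
begin

abbreviation "n \<equiv> dim_col (mat_A I)"
abbreviation "inp \<equiv> load (enc_input I) ''in''"
abbreviation "frac_x \<equiv> \<lambda>i. real (num_in m inp i) / real (den_in m inp i)"

lemma rhs_d: "rhs_d I \<in> carrier_vec (dim_row (mat_A I))"
  and obj_c: "dim_vec (obj_c I) = n"
  using input by (auto simp: config_sp_input_def)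

lemma x_polytope: "dim_vec (real_x I) = n"
    "r < m \<Longrightarrow> (\<Sum>i<n. real (mat_A I $$ (r, i)) * real_x I $ i) \<le> rhs_d I $ r"
    "i < n \<Longrightarrow> 0 \<le> real_x I $ i \<and> real_x I $ i \<le> 1"
  using input polytope_iff[OF rhs_d, of "real_x I"] rows
  by (auto simp: config_sp_input_def optimal_solution_def)

lemma opt_x: "dim_vec (opt_x I) = n"
  using x_polytope(1) by (simp add: real_x_def)

lemma
  shows length_enc: "length (enc_input I) = 2 + m * n + m + n + 2 * n"
    and dim_in: "dim_in inp = n"
    and weight_in: "r < m \<Longrightarrow> i < n \<Longrightarrow> weight_in inp r i = row (mat_A I) r $ i"
    and capacity_in: "r < m \<Longrightarrow> capacity_in m inp r = rhs_d I $ r"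
    and num_in: "i < n \<Longrightarrow> num_in m inp i = nat (fst (quotient_of (opt_x I $ i)))"
    and den_in: "i < n \<Longrightarrow> den_in m inp i = nat (snd (quotient_of (opt_x I $ i)))"
  using load_enc_input[of I] rhs_d obj_c opt_x rows by auto

text \<open>Feasibility makes the coordinates nonnegative, so \<open>nat\<close> loses nothing of
  the numerator.\<close>

lemma frac_x: "i < n \<Longrightarrow> 0 < den_in m inp i \<and> real_x I $ i = frac_x i"
proof -
  assume i: "i < n"
  obtain p q where pq: "quotient_of (opt_x I $ i) = (p, q)" by force
  have q: "0 < q" using quotient_of_denom_pos[OF pq] .
  have x: "real_x I $ i = real_of_int p / real_of_int q"
    using i opt_x quotient_of_div[OF pq] by (simp add: real_x_def of_rat_divide)
  then have "0 \<le> p" using x_polytope(3)[OF i] q by (simp add: zero_le_divide_iff)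
  then show ?thesis using q x by (simp add: num_in[OF i] den_in[OF i] pq)
qed

lemma guess_violated:
  assumes "good_guess m inp G"
  shows "violated_configuration I (digit (inp 0) G 0) (guess_set m inp G) (digit (inp 0) G 1)
    (digit (inp 0) G 2) (guess_set m inp G)"
proof -
  define r t k where "r = digit (inp 0) G 0" and "t = digit (inp 0) G 1" and "k = digit (inp 0) G 2"
  let ?S = "guess_set m inp G"
  have r: "r < m"
    and test: "violation_test n (weight_in inp r) (rhs_d I $ r) (num_in m inp) (den_in m inp) ?S t k"
    using assms capacity_in by (auto simp: good_guess_def Let_def dim_in r_def t_def k_def)
  have S: "?S \<subseteq> {..<n}" "t \<notin> ?S"
    using guess_set_subset[of m inp G] by (auto simp: dim_in guess_set_def Let_def t_def)
  have "violated n (weight_in inp r) (rhs_d I $ r) frac_x ?S t k"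
    using test violation_test_iff[OF S, of "den_in m inp" frac_x "num_in m inp"] frac_x by blast
  then have "violated n (($) (row (mat_A I) r)) (rhs_d I $ r) (($) (real_x I)) ?S t k"
    by (rule violated_cong[rotated 2]) (simp_all add: weight_in[OF r] frac_x)
  then have "configuration (row (mat_A I) r) (rhs_d I $ r) ?S t k
      \<and> \<not> configuration_ineq ?S t k (real_x I)"
    using violated_iff[of "row (mat_A I) r"] by simp
  moreover have "k \<le> card ?S" using test by (simp add: violation_test_def)
  ultimately show ?thesis
    using r by (simp add: violated_configuration_def rows r_def t_def k_def)
qed

lemma guess_exists:
  assumes "violated_configuration I r N t0 k0 S0"
  shows "\<exists>G<inp 0 ^ guess_length m. good_guess m inp G"
proof -
  have r: "r < m" using assms rows by (simp add: violated_configuration_def)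
  define a where "a = weight_in inp r"
  \<comment> \<open>The inequality mentions only \<open>S0\<close>, and subsets of \<open>S0\<close>
    are subsets of \<open>N\<close>, so \<open>N\<close> may be shrunk to \<open>S0\<close>.\<close>
  have "configuration (row (mat_A I) r) (rhs_d I $ r) S0 t0 k0"
    using assms configuration_subset by (auto simp: violated_configuration_def)
  then have "violated n (($) (row (mat_A I) r)) (rhs_d I $ r) (($) (real_x I)) S0 t0 k0"
    using assms violated_iff[of "row (mat_A I) r"] by (simp add: violated_configuration_def)
  then have viol: "violated n a (rhs_d I $ r) frac_x S0 t0 k0"
    by (rule violated_cong[rotated 2]) (simp_all add: a_def weight_in[OF r] frac_x)
  interpret knapsack_point n a "rhs_d I $ r" frac_x m
  proof
    show "0 \<le> frac_x i \<and> frac_x i \<le> 1" if "i < n" for i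
      using x_polytope(3)[OF that] frac_x[OF that] by simp
    have "(\<Sum>i<n. real (a i) * frac_x i) = (\<Sum>i<n. real (mat_A I $$ (r, i)) * real_x I $ i)"
      using r rows by (intro sum.cong) (simp_all add: a_def weight_in frac_x)
    then show "(\<Sum>i<n. real (a i) * frac_x i) \<le> real (rhs_d I $ r)"
      using x_polytope(2)[OF r] by simp
    have "{i. i < n \<and> 0 < frac_x i \<and> frac_x i < 1}
        = {i. i < n \<and> 0 < real_x I $ i \<and> real_x I $ i < 1}"
      using frac_x by auto
    then show "card {i. i < n \<and> 0 < frac_x i \<and> frac_x i < 1} \<le> m"
      using extreme_point_card_fractional[OF rhs_d extreme] rows by simp
  qed
  from candidate_of_violated[OF viol] obtain t k u z P R where
    tuz: "t < n" "u < n" "z < n" and P: "P \<subseteq> {..<n}" "card P \<le> m + 1"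
    and R: "R \<subseteq> {..<n}" "card R \<le> 2 * m"
    and cand: "violated n a (rhs_d I $ r) frac_x (candidate n a frac_x t u z P R) t k"
    unfolding has_candidate_def by blast
  define S where "S = candidate n a frac_x t u z P R"
  have Sn: "S \<subseteq> {..<n}" and tS: "t \<notin> S" by (auto simp: S_def candidate_def)
  have "k \<le> n"
    using cand card_mono[OF _ Sn] by (simp add: violated_def S_def)
  obtain ps where ps: "length ps = m + 1" "\<And>i. i \<in> set ps \<Longrightarrow> i \<le> n"
    "\<And>i. i < n \<Longrightarrow> i \<in> set ps \<longleftrightarrow> i \<in> P" using padded_list_exists[OF P] by blast
  obtain rs where rs: "length rs = 2 * m" "\<And>i. i \<in> set rs \<Longrightarrow> i \<le> n"
    "\<And>i. i < n \<Longrightarrow> i \<in> set rs \<longleftrightarrow> i \<in> R" using padded_list_exists[OF R] by blast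
  define ds where "ds = [r, t, k, u, z] @ ps @ rs"
  have len: "length ds = guess_length m" using ps rs by (simp add: ds_def guess_length_def)
  \<comment> \<open>The base is the length of the input word, which exceeds both \<open>m\<close>
    and \<open>n\<close>; so row numbers, indices, \<open>k \<le> n\<close> and the filler
    \<open>n\<close> are all digits.\<close>
  have small: "n < inp 0" "r < inp 0" using length_enc r by simp_all
  then have "\<forall>q\<in>set ds. q < inp 0"
    using tuz \<open>k \<le> n\<close> ps(2) rs(2) by (force simp: ds_def)
  from digits_exist[OF this] obtain G where
    G: "G < inp 0 ^ guess_length m" "\<And>i. i < guess_length m \<Longrightarrow> digit (inp 0) G i = ds ! i"
    unfolding len by blast
  have dg: "digit (inp 0) G 0 = r" "digit (inp 0) G 1 = t" "digit (inp 0) G 2 = k"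
    "digit (inp 0) G 3 = u" "digit (inp 0) G 4 = z"
    using G(2) by (simp_all add: guess_length_def ds_def)
  have dg_image: "digit (inp 0) G ` {i..<j} = (\<lambda>i. ds ! i) ` {i..<j}" if "j \<le> guess_length m" for i j
    using G(2) that by (intro image_cong) auto
  have "{5..<6 + m} = {length [r, t, k, u, z]..<length [r, t, k, u, z] + length ps}"
    using ps(1) by (simp add: eval_nat_numeral)
  then have "(\<lambda>i. ds ! i) ` {5..<6 + m} = set ps"
    unfolding ds_def by (simp only: nth_image_middle)
  then have dP: "digit (inp 0) G ` {5..<6 + m} = set ps"
    using dg_image[of "6 + m" 5] by (simp add: guess_length_def)
  have "{6 + m..<6 + 3 * m}
      = {length ([r, t, k, u, z] @ ps)..<length ([r, t, k, u, z] @ ps) + length rs}"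
  proof -
    have "length ([r, t, k, u, z] @ ps) = 6 + m" using ps(1) by simp
    then show ?thesis using rs(1) by (simp only:) (simp add: add.commute)
  qed
  then have "(\<lambda>i. ds ! i) ` {6 + m..<6 + 3 * m} = set rs"
    using nth_image_middle[of "[r, t, k, u, z] @ ps" rs "[]"]
    by (simp only: ds_def append_Nil2 append_assoc)
  then have dR: "digit (inp 0) G ` {6 + m..<6 + 3 * m} = set rs"
    using dg_image[of "6 + 3 * m" "6 + m"] by (simp add: guess_length_def)
  have one: "frac_x i = 1 \<longleftrightarrow> num_in m inp i = den_in m inp i" if "i < n" for i
    using frac_x[OF that] by auto
  have "guess_set m inp G = S"
    unfolding guess_set_def Let_def dim_in dg dP dR S_def candidate_def a_def
    using one ps(3) rs(3) by blast
  moreover have "violation_test n a (rhs_d I $ r) (num_in m inp) (den_in m inp) S t k"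
    using cand violation_test_iff[OF Sn tS, of "den_in m inp" frac_x "num_in m inp"] frac_x
    unfolding S_def by blast
  ultimately have "good_guess m inp G"
    unfolding good_guess_def Let_def dg using r capacity_in[OF r] by (simp add: dim_in a_def)
  with G(1) show ?thesis by blast
qed

lemma answer_correct:
  "eval (E_answer_length m) inp (\<lambda>_. 0) \<le> length (enc_input I) ^ 2 \<and>
   config_sp_answer I (map (\<lambda>j. eval (E_answer m) inp ((\<lambda>_. 0)(0 := j)))
     [0..<eval (E_answer_length m) inp (\<lambda>_. 0)])"
proof -
  have dim: "dim_in inp \<le> inp 0" using dim_in length_enc by simp
  \<comment> \<open>The exponent 2 absorbs the factor 2, as the word has length at least 2.\<close>
  have "4 + 2 * n \<le> 2 * length (enc_input I)" using length_enc by simp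
  also have "\<dots> \<le> length (enc_input I) ^ 2"
    unfolding power2_eq_square using length_enc by (intro mult_right_mono) auto
  finally have bound: "4 + 2 * n \<le> length (enc_input I) ^ 2" .
  show ?thesis
  proof (cases "\<exists>G<inp 0 ^ guess_length m. good_guess m inp G")
    case True
    then obtain G0 where G0: "G0 < inp 0 ^ guess_length m" "good_guess m inp G0" by blast
    define G where "G = (LEAST G. good_guess m inp G)"
    have G: "good_guess m inp G" "G \<le> G0" "\<And>G'. G' < G \<Longrightarrow> \<not> good_guess m inp G'"
      using G0(2) not_less_Least unfolding G_def by (auto intro: LeastI Least_le)
    have G_less: "G < inp 0 ^ guess_length m" using G(2) G0(1) by (rule le_less_trans)
    have ans: "eval (E_answer_length m) inp (\<lambda>_. 0) = 4 + 2 * dim_in inp"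
      "map (\<lambda>j. eval (E_answer m) inp ((\<lambda>_. 0)(0 := j))) [0..<4 + 2 * dim_in inp]
        = answer_word m inp G"
      using answer_some[OF dim G_less G(1)] G(3) by blast+
    have "\<exists>r N t k S. violated_configuration I r N t k S"
      using guess_violated[OF G(1)] by blast
    moreover have "\<exists>r N t k S. violated_configuration I r N t k S \<and>
        answer_word m inp G = [1, r, t, k] @ enc_set n N @ enc_set n S"
      by (intro exI conjI, rule guess_violated[OF G(1)])
        (simp only: answer_word_def Let_def dim_in)
    ultimately have "config_sp_answer I (answer_word m inp G)"
      by (simp only: config_sp_answer_def if_True)
    then show ?thesis using bound unfolding ans(1) ans(2) by (simp add: dim_in)
  next
    case False
    then have none: "\<not> good_guess m inp G" if "G < inp 0 ^ guess_length m" for G using that by blast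
    have "\<not> (\<exists>r N t k S. violated_configuration I r N t k S)" using guess_exists False by blast
    then show ?thesis
      using bound answer_none[OF dim none] unfolding config_sp_answer_def by simp
  qed
qed

end

text \<open>The expressions are built for the given \<open>m\<close>: the search has
  \<open>inp 0 ^ (6 + 3 * m)\<close> rounds, from five single digits, \<open>m + 1\<close> for
  \<open>P\<close> and \<open>2 * m\<close> for \<open>R\<close>. Program and polynomial therefore
  depend on \<open>m\<close>.\<close>

theorem corollary2:
  fixes m :: nat
  shows "solvable_in_polynomial_time enc_input
    {I. config_sp_input I \<and> dim_row (mat_A I) = m \<and>
        extreme_point (real_x I) (polytope (mat_A I) (rhs_d I))}
    config_sp_answer"
proof (rule solvable_by_expr)
  fix I
  assume "I \<in> {I. config_sp_input I \<and> dim_row (mat_A I) = m \<and>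
    extreme_point (real_x I) (polytope (mat_A I) (rhs_d I))}"
  then interpret config_instance I m by unfold_locales auto
  show "eval (E_answer_length m) inp (\<lambda>_. 0) \<le> length (enc_input I) ^ 2 \<and>
    config_sp_answer I (map (\<lambda>j. eval (E_answer m) inp ((\<lambda>_. 0)(0 := j)))
      [0..<eval (E_answer_length m) inp (\<lambda>_. 0)])"
    by (rule answer_correct)
qed

end
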